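(* For every integer $n\geq 3$, the diameter of the commuting graph of the ring $\mathrm{M}_n(\mathbb{R})$ of $n\times n$ real matrices is equal to four: $\mathrm{diam}(\Gamma(\mathrm{M}_n(\mathbb{R})))=4$.
   Context: For a ring $R$, the commuting graph $\Gamma(R)$ is the simple undirected graph whose vertices are all non-central elements of $R$, and in which two distinct vertices $a$ and $b$ are adjacent if and only if $ab=ba$. In a graph $G$, a path is a sequence of distinct vertices $(v_1,\ldots,v_k)$ such that every two consecutive vertices are adjacent; its length is $k-1$. The distance $d(u,v)$ between two vertices $u,v$ is the length of a shortest path between $u$ and $v$ if such a path exists, and $d(u,v)=\infty$ otherwise. The diameter of $G$ is $\mathrm{diam}(G)=\sup\{d(u,v) : u \text{ and } v \text{ are distinct vertices of } G\}$. *)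

theory Defs
  imports
    "HOL-Algebra.Ring"
    "HOL-Library.Extended_Nat"
    "Graph_Theory.Vertex_Walk"
    "Jordan_Normal_Form.Matrix"
begin

definition ring_center :: "('a, 'm) ring_scheme \<Rightarrow> 'a set" where
  "ring_center R = {a \<in> carrier R. \<forall>b \<in> carrier R. a \<otimes>\<^bsub>R\<^esub> b = b \<otimes>\<^bsub>R\<^esub> a}"

text \<open>
  A simple undirected graph is modelled as a symmetric loop-free digraph without parallel arcs
  (see the lemma following the definition): the edge between \<open>a\<close> and \<open>b\<close> is the pair of arcs
  \<open>(a, b)\<close>, \<open>(b, a)\<close>. The locale \<open>graph\<close> of the library is not applicable because it also
  requires finitely many vertices.
\<close>

definition commuting_graph :: "('a, 'm) ring_scheme \<Rightarrow> ('a, 'a \<times> 'a) pre_digraph" where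
  "commuting_graph R =
    \<lparr> verts = carrier R - ring_center R,
      arcs = {(a, b). a \<in> carrier R - ring_center R \<and> b \<in> carrier R - ring_center R
                \<and> a \<noteq> b \<and> a \<otimes>\<^bsub>R\<^esub> b = b \<otimes>\<^bsub>R\<^esub> a},
      tail = fst, head = snd \<rparr>"

lemma commuting_graph_simple:
  shows "sym_digraph (commuting_graph R)"
    and "loopfree_digraph (commuting_graph R)"
    and "nomulti_digraph (commuting_graph R)"
  by unfold_locales
    (auto simp: commuting_graph_def symmetric_conv arc_to_ends_def)

text \<open>
  A \<open>vpath\<close> is a nonempty list of distinct, consecutively adjacent vertices and
  \<open>vwalk_length\<close> counts its arcs. If there is no path from \<open>u\<close> to \<open>v\<close>, the infimum is
  taken over the empty set and equals \<open>\<infinity>\<close>.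
\<close>

definition graph_dist :: "('a, 'b) pre_digraph \<Rightarrow> 'a \<Rightarrow> 'a \<Rightarrow> enat" where
  "graph_dist G u v = (INF p \<in> {p. vpath p G \<and> hd p = u \<and> last p = v}. enat (vwalk_length p))"

definition graph_diameter :: "('a, 'b) pre_digraph \<Rightarrow> enat" where
  "graph_diameter G =
    Sup {graph_dist G u v | u v. u \<in> verts G \<and> v \<in> verts G \<and> u \<noteq> v}"

end

theory Submission
  imports
    Defs
    "Jordan_Normal_Form.Char_Poly"
    "HOL-Computational_Algebra.Fundamental_Theorem_Algebra"
begin

text \<open>
  The centre of the real \<open>n \<times> n\<close> matrices consists of the scalar matrices, so the vertices of the graph
  are the nonscalar matrices (\<open>verts_commuting_graph_mat\<close>).

  Distance at most four. Between nonscalar \<open>A\<close> and \<open>B\<close> one looks for nonscalar \<open>X\<close>, \<open>Z\<close>, \<open>Y\<close> such that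
  consecutive members of \<open>A, X, Z, Y, B\<close> commute. The matrices \<open>X\<close> and \<open>Y\<close> can be chosen to be of two
  simple kinds. If \<open>A\<close> has a real eigenvalue, then it commutes with the rank one matrix \<open>x y\<^sup>T\<close> formed
  from a right and a left eigenvector for that eigenvalue. Otherwise \<open>A\<close> commutes with some \<open>J\<close> such
  that \<open>J\<^sup>2 = -1\<close>, namely a polynomial in \<open>A\<close>: an annihilating polynomial of minimal degree has no real
  root, and modulo a real polynomial without real roots \<open>-1\<close> is a square
  (\<open>real_poly_without_roots_dvd_square_plus_one\<close>). It remains to find a nonscalar \<open>Z\<close> that commutes with
  two matrices of these kinds.

  \<^item> For \<open>x y\<^sup>T\<close> and \<open>u v\<^sup>T\<close> one takes \<open>Z = z w\<^sup>T\<close> with \<open>z\<close> orthogonal to \<open>y, v\<close> and \<open>w\<close> orthogonal to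
    \<open>x, u\<close>; all products vanish. This is where \<open>n \<ge> 3\<close> enters.

  \<^item> For \<open>x y\<^sup>T\<close> and \<open>J\<close> one takes \<open>Z = z w\<^sup>T - (J z)(J\<^sup>T w)\<^sup>T\<close>, which is a rank one matrix with respect to
    the complex vector space structure given by \<open>J\<close>, and again has to satisfy two orthogonality
    conditions on each of \<open>z\<close> and \<open>w\<close>.

  \<^item> For \<open>J\<close> and \<open>L\<close> with \<open>J\<^sup>2 = L\<^sup>2 = -1\<close> the matrix \<open>J L + L J\<close> commutes with both. If it is a scalar \<open>c\<close>,
    then \<open>K = L + (c/2) J\<close> anticommutes with \<open>J\<close>, and \<open>K\<^sup>2\<close> is a scalar \<open>\<tau>\<close>. The matrices
    \<open>\<tau> W + K W K\<close>, where \<open>W\<close> commutes with \<open>J\<close>, commute with both \<open>J\<close> and \<open>K\<close>, and a suitable one of them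
    is nonscalar (\<open>anticommuting_common_commutant\<close>).

  Distance at least four. Let \<open>A\<close> be diagonal with distinct entries and let \<open>B\<close> be a nilpotent Jordan
  block in another basis, with kernel spanned by \<open>p\<close> and with \<open>q\<^sup>T\<close> spanning its left kernel. A nonscalar
  \<open>X\<close> commuting with \<open>A\<close> is diagonal, and any \<open>Y\<close> commuting with \<open>X\<close> commutes with the coordinate
  projection \<open>e\<close> onto an eigenspace of \<open>X\<close>. If \<open>Y\<close> also commutes with \<open>B\<close>, then for the eigenvalue \<open>y\<close> of
  \<open>Y\<close> the kernel of \<open>Y - y\<close> contains \<open>p\<close>, hence \<open>e p\<close>; if \<open>Y \<noteq> y\<close> this kernel lies in the hyperplane
  \<open>q\<^sup>T z = 0\<close>. So \<open>Y\<close> is scalar as soon as \<open>q\<^sup>T e p \<noteq> 0\<close>, that is, as soon as no sum of the numbers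
  \<open>q\<^sub>i p\<^sub>i\<close> over a nonempty proper set of indices is zero. For \<open>p = (1, ..., 1)\<close> and
  \<open>q = (1, ..., 1, 1 - n)\<close> this holds (\<open>corner_of_conjugated_projection\<close>).
\<close>

section \<open>Distances in a commuting graph\<close>

lemma length_vwalk_to_vpath_le: "length (vwalk_to_vpath p) \<le> length p"
proof (induct p rule: vwalk_to_vpath_induct3)
  case (in_set x xs)
  have "length (dropWhile (\<lambda>y. y \<noteq> x) xs) \<le> length xs"
    by (rule length_dropWhile_le)
  with in_set show ?case by simp
qed auto

text \<open>
  Distances are defined through paths, but repeated vertices may be allowed when bounding a distance
  from above: cutting the loops out of a walk does not make it longer.
\<close>

lemma graph_dist_le_vwalk:
  assumes "vwalk p G"
  shows "graph_dist G (hd p) (last p) \<le> enat (length p - 1)"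
proof -
  let ?q = "vwalk_to_vpath p"
  have "graph_dist G (hd p) (last p) \<le> enat (vwalk_length ?q)"
    unfolding graph_dist_def
    by (rule INF_lower) (simp add: vwalk_to_vpath_vpath[OF assms] vwalk_to_vpath_hd vwalk_to_vpath_last)
  also have "\<dots> \<le> enat (length p - 1)"
    using length_vwalk_to_vpath_le[of p] by simp
  finally show ?thesis .
qed

lemma verts_commuting_graph: "verts (commuting_graph R) = carrier R - ring_center R"
  by (simp add: commuting_graph_def)

lemma arcs_ends_commuting_graph:
  "arcs_ends (commuting_graph R) =
    {(a, b). a \<in> verts (commuting_graph R) \<and> b \<in> verts (commuting_graph R)
      \<and> a \<noteq> b \<and> a \<otimes>\<^bsub>R\<^esub> b = b \<otimes>\<^bsub>R\<^esub> a}"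
  by (auto simp: commuting_graph_def arcs_ends_def arc_to_ends_def)

lemma vwalk_remdups_adj_commuting:
  assumes "p \<noteq> []" "set p \<subseteq> verts (commuting_graph R)"
    and "successively (\<lambda>a b. a \<otimes>\<^bsub>R\<^esub> b = b \<otimes>\<^bsub>R\<^esub> a) p"
  shows "vwalk (remdups_adj p) (commuting_graph R)"
  using assms
proof (induct p rule: remdups_adj.induct)
  case (3 x y xs)
  then show ?case
    by (auto intro!: vwalk_consI simp: arcs_ends_commuting_graph)
qed auto

text \<open>
  Consecutive members of the chain are allowed to coincide, so that a chain can be given uniformly
  without checking which of its members happen to be equal.
\<close>

lemma graph_dist_le_commuting_chain:
  assumes "p \<noteq> []" "set p \<subseteq> verts (commuting_graph R)"
    and "successively (\<lambda>a b. a \<otimes>\<^bsub>R\<^esub> b = b \<otimes>\<^bsub>R\<^esub> a) p"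
  shows "graph_dist (commuting_graph R) (hd p) (last p) \<le> enat (length p - 1)"
proof -
  have "graph_dist (commuting_graph R) (hd p) (last p) \<le> enat (length (remdups_adj p) - 1)"
    using graph_dist_le_vwalk[OF vwalk_remdups_adj_commuting[OF assms]] by simp
  also have "\<dots> \<le> enat (length p - 1)"
    using remdups_adj_length[of p] by (simp add: diff_le_mono)
  finally show ?thesis .
qed

text \<open>
  On a path with at most three arcs the second vertex commutes with \<open>a\<close>, the last but one commutes
  with \<open>b\<close>, and they commute with each other. Shorter paths are the cases in which some of these
  vertices coincide.
\<close>

lemma graph_dist_ge_4:
  assumes a: "a \<in> verts (commuting_graph R)" and b: "b \<in> verts (commuting_graph R)"
    and far: "\<And>x y. \<lbrakk>x \<in> verts (commuting_graph R); y \<in> verts (commuting_graph R);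
      a \<otimes>\<^bsub>R\<^esub> x = x \<otimes>\<^bsub>R\<^esub> a; b \<otimes>\<^bsub>R\<^esub> y = y \<otimes>\<^bsub>R\<^esub> b; x \<otimes>\<^bsub>R\<^esub> y = y \<otimes>\<^bsub>R\<^esub> x\<rbrakk> \<Longrightarrow> False"
  shows "graph_dist (commuting_graph R) a b \<ge> 4"
  unfolding graph_dist_def
proof (rule INF_greatest)
  fix p assume "p \<in> {p. vpath p (commuting_graph R) \<and> hd p = a \<and> last p = b}"
  then have w: "vwalk p (commuting_graph R)" and h: "hd p = a" and l: "last p = b" by auto
  have "\<not> length p \<le> 4"
  proof
    assume "length p \<le> 4"
    moreover have "p \<noteq> []" using w by auto
    ultimately have "length p = 1 \<or> length p = 2 \<or> length p = 3 \<or> length p = 4"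
      by (cases "length p") (auto simp: le_Suc_eq eval_nat_numeral)
    then consider "p = [a]" "a = b" | "p = [a, b]" | x where "p = [a, x, b]" | x y where "p = [a, x, y, b]"
      using h l by (auto simp: length_Suc_conv eval_nat_numeral)
    then show False
    proof cases
      case 1
      then show False using far[of a a] a b by auto
    next
      case 2
      then show False using far[of a b] w a b by (auto simp: vwalk_def arcs_ends_commuting_graph)
    next
      case 3
      then show False using far[of x x] w by (auto simp: vwalk_def arcs_ends_commuting_graph)
    next
      case 4
      then show False using far[of x y] w by (auto simp: vwalk_def arcs_ends_commuting_graph)
    qed
  qed
  then show "4 \<le> enat (vwalk_length p)"
    by (simp add: numeral_eq_enat)
qed

section \<open>Square roots of minus one modulo a real polynomial\<close>

abbreviation cpoly :: "real poly \<Rightarrow> complex \<Rightarrow> complex" where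
  "cpoly p z \<equiv> poly (map_poly of_real p) z"

lemma cpoly_simps:
  "cpoly (p + q) z = cpoly p z + cpoly q z"
  "cpoly (p * q) z = cpoly p z * cpoly q z"
proof -
  interpret map_poly_comm_ring_hom "of_real :: real \<Rightarrow> complex" ..
  show "cpoly (p + q) z = cpoly p z + cpoly q z" "cpoly (p * q) z = cpoly p z * cpoly q z"
    by (simp_all add: hom_distribs)
qed

lemma cpoly_linear: "cpoly [:a, b:] z = of_real a + z * of_real b"
  by (simp add: of_real_hom.map_poly_pCons_hom)

lemma real_quadratic_dvd:
  assumes im: "Im z \<noteq> 0" and root: "cpoly p z = 0"
  shows "[:(Re z)\<^sup>2 + (Im z)\<^sup>2, - 2 * Re z, 1:] dvd p"
proof -
  let ?q = "[:(Re z)\<^sup>2 + (Im z)\<^sup>2, - 2 * Re z, 1:]"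
  have q: "cpoly ?q z = 0"
    by (simp add: of_real_hom.map_poly_pCons_hom complex_eq_iff algebra_simps power2_eq_square)
  have "degree (p mod ?q) < 2"
    using degree_mod_less[of ?q p] by auto
  then have "p mod ?q = [:coeff (p mod ?q) 0, coeff (p mod ?q) 1:]"
    by (intro poly_eqI) (auto simp: coeff_pCons coeff_eq_0 split: nat.split)
  then obtain a b where ab: "p mod ?q = [:a, b:]" by blast
  have "cpoly p z = cpoly (p div ?q) z * cpoly ?q z + cpoly (p mod ?q) z"
    by (metis cpoly_simps div_mult_mod_eq)
  then have "of_real a + z * of_real b = 0"
    using root q ab by (simp add: cpoly_linear)
  then have "a = 0" "b = 0"
    using im by (auto simp: complex_eq_iff)
  then show ?thesis
    using ab by (simp add: mod_eq_0_iff_dvd)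
qed

lemma complex_quadratic_solvable:
  fixes a b c :: complex
  assumes "a \<noteq> 0 \<or> b \<noteq> 0"
  shows "\<exists>w. c + b * w + a * w\<^sup>2 = 0"
proof -
  have "\<exists>w. poly [:c, b, a:] w = 0"
    by (rule fundamental_theorem_of_algebra_alt) (use assms in auto)
  then show ?thesis
    by (auto simp: algebra_simps power2_eq_square)
qed

text \<open>
  By induction on the degree, in the manner of Hensel lifting. Split off the real quadratic factor
  \<open>q\<close> of a nonreal root \<open>z\<close>, so that \<open>c = q c'\<close> and \<open>g\<^sup>2 + 1 = c' h\<close>. Then
  \<open>(g + c' k)\<^sup>2 + 1 = c' (h + 2 g k + c' k\<^sup>2)\<close>, and the second factor has to vanish at \<open>z\<close>. This is a quadratic
  equation for the complex number \<open>k(z)\<close>. It is solvable unless \<open>g(z) = c'(z) = 0\<close>, which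
  \<open>g\<^sup>2 + 1 = c' h\<close> excludes. Since \<open>z\<close> is not real, every complex value is attained at \<open>z\<close> by a real linear
  polynomial \<open>k\<close>. This argument works for multiple roots as well as for simple ones.
\<close>

lemma real_poly_without_roots_dvd_square_plus_one:
  fixes c :: "real poly"
  assumes "\<And>x. poly c x \<noteq> 0"
  shows "\<exists>g. c dvd g * g + 1"
  using assms
proof (induct "degree c" arbitrary: c rule: less_induct)
  case less
  have c0: "c \<noteq> 0" using less.prems by auto
  show ?case
  proof (cases "degree c = 0")
    case True
    then have "is_unit c" using c0 by (metis is_unit_iff_degree)
    then show ?thesis by (metis unit_imp_dvd)
  next
    case False
    then have "\<exists>z. cpoly c z = 0"
      by (intro fundamental_theorem_of_algebra_alt) (auto simp: of_real_hom.map_poly_pCons_hom dest!: arg_cong[where f = degree])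
    then obtain z where z: "cpoly c z = 0" by auto
    have im: "Im z \<noteq> 0"
    proof
      assume "Im z = 0"
      then have "z = of_real (Re z)" by (simp add: complex_eq_iff)
      then have "complex_of_real (poly c (Re z)) = 0"
        using z by (metis of_real_hom.poly_map_poly)
      then show False using less.prems by simp
    qed
    let ?q = "[:(Re z)\<^sup>2 + (Im z)\<^sup>2, - 2 * Re z, 1:]"
    obtain c' where c': "c = ?q * c'"
      using real_quadratic_dvd[OF im z] by (auto elim: dvdE)
    have "degree c = 2 + degree c'"
      using c0 unfolding c' by (subst degree_mult_eq) auto
    moreover have "poly c' x \<noteq> 0" for x
      using less.prems[of x] unfolding c' by auto
    ultimately obtain g where "c' dvd g * g + 1"
      using less.hyps[of c'] by auto
    then obtain h where h: "g * g + 1 = c' * h" by (auto elim: dvdE)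
    have "cpoly (g * g + 1) z = cpoly c' z * cpoly h z"
      unfolding h by (simp add: cpoly_simps)
    then have "cpoly g z * cpoly g z + 1 = cpoly c' z * cpoly h z"
      by (simp add: cpoly_simps)
    then have "cpoly c' z \<noteq> 0 \<or> 2 * cpoly g z \<noteq> 0"
      by auto
    then obtain w where w: "cpoly h z + 2 * cpoly g z * w + cpoly c' z * w\<^sup>2 = 0"
      using complex_quadratic_solvable by blast
    \<comment> \<open>The real linear polynomial with value \<open>w\<close> at \<open>z\<close>.\<close>
    define k where "k = [:Re w - Re z * (Im w / Im z), Im w / Im z:]"
    have k: "cpoly k z = w"
      unfolding k_def cpoly_linear using im by (simp add: complex_eq_iff)
    have "cpoly (h + g * k + g * k + c' * (k * k)) z = 0"
      unfolding cpoly_simps k using w by (simp add: power2_eq_square algebra_simps)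
    then have "?q dvd h + g * k + g * k + c' * (k * k)"
      by (rule real_quadratic_dvd[OF im])
    moreover have "(g + c' * k) * (g + c' * k) + 1 = c' * (h + g * k + g * k + c' * (k * k))"
      using h by (simp add: algebra_simps)
    ultimately have "c dvd (g + c' * k) * (g + c' * k) + 1"
      unfolding c' by (metis mult.commute dvd_refl mult_dvd_mono)
    then show ?thesis by blast
  qed
qed

section \<open>Polynomials evaluated at a matrix\<close>

definition poly_at_mat :: "nat \<Rightarrow> real mat \<Rightarrow> real poly \<Rightarrow> real mat" where
  "poly_at_mat n A p = fold_coeffs (\<lambda>a M. a \<cdot>\<^sub>m 1\<^sub>m n + A * M) p (0\<^sub>m n n)"

lemma zero_smult_add_mat: "M \<in> carrier_mat n n \<Longrightarrow> 0 \<cdot>\<^sub>m 1\<^sub>m n + M = (M :: real mat)"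
  by (intro eq_matI) auto

lemma smult_one_mat: "1 \<cdot>\<^sub>m M = (M :: real mat)"
  by (intro eq_matI) auto

lemma mult_mat_zero_vec: "M \<in> carrier_mat n n \<Longrightarrow> M *\<^sub>v 0\<^sub>v n = (0\<^sub>v n :: real vec)"
  by (intro eq_vecI) auto

lemma smult_smult_mat: "a \<cdot>\<^sub>m (b \<cdot>\<^sub>m M) = (a * b) \<cdot>\<^sub>m (M :: real mat)"
  by (intro eq_matI) auto

lemma smult_mat_mult_vec:
  fixes M :: "real mat"
  assumes "M \<in> carrier_mat n n" "v \<in> carrier_vec n"
  shows "(c \<cdot>\<^sub>m M) *\<^sub>v v = c \<cdot>\<^sub>v (M *\<^sub>v v)"
  using assms by (intro eq_vecI) auto

lemma zero_mult_mat_vec: "v \<in> carrier_vec n \<Longrightarrow> 0\<^sub>m n n *\<^sub>v v = (0\<^sub>v n :: real vec)"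
  by (intro eq_vecI) auto

context
  fixes n :: nat and A :: "real mat"
  assumes A: "A \<in> carrier_mat n n"
begin

lemma poly_at_mat_0: "poly_at_mat n A 0 = 0\<^sub>m n n"
  by (simp add: poly_at_mat_def)

lemma poly_at_mat_pCons: "poly_at_mat n A (pCons a p) = a \<cdot>\<^sub>m 1\<^sub>m n + A * poly_at_mat n A p"
proof (cases "p = 0 \<and> a = 0")
  case True
  then show ?thesis using A by (auto simp: poly_at_mat_def)
next
  case False
  then show ?thesis by (auto simp: poly_at_mat_def)
qed

lemma poly_at_mat_carrier: "poly_at_mat n A p \<in> carrier_mat n n"
  using A by (induct p) (auto simp: poly_at_mat_0 poly_at_mat_pCons)

lemma poly_at_mat_add: "poly_at_mat n A (p + q) = poly_at_mat n A p + poly_at_mat n A q"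
proof (induct p arbitrary: q)
  case 0
  show ?case using poly_at_mat_carrier[of q] by (simp add: poly_at_mat_0)
next
  case (pCons a p)
  obtain b r where q: "q = pCons b r" by (cases q)
  show ?case
    using A poly_at_mat_carrier[of p] poly_at_mat_carrier[of r]
    unfolding q add_pCons poly_at_mat_pCons pCons(2) mult_add_distrib_mat[OF A poly_at_mat_carrier poly_at_mat_carrier]
    by (intro eq_matI) (auto simp: algebra_simps simp del: index_mult_mat(1))
qed

lemma poly_at_mat_smult: "poly_at_mat n A (smult c p) = c \<cdot>\<^sub>m poly_at_mat n A p"
proof (induct p)
  case 0
  show ?case by (simp add: poly_at_mat_0)
next
  case (pCons a p)
  show ?case
    using A poly_at_mat_carrier[of p]
    unfolding smult_pCons poly_at_mat_pCons pCons(2) mult_smult_distrib[OF A poly_at_mat_carrier]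
    by (intro eq_matI) (auto simp: algebra_simps simp del: index_mult_mat(1))
qed

lemma poly_at_mat_mult: "poly_at_mat n A (p * q) = poly_at_mat n A p * poly_at_mat n A q"
proof (induct p)
  case 0
  show ?case using poly_at_mat_carrier[of q] by (simp add: poly_at_mat_0)
next
  case (pCons a p)
  note P = poly_at_mat_carrier[of p] and Q = poly_at_mat_carrier[of q]
  have "(a \<cdot>\<^sub>m 1\<^sub>m n + A * poly_at_mat n A p) * poly_at_mat n A q
    = a \<cdot>\<^sub>m poly_at_mat n A q + A * (poly_at_mat n A p * poly_at_mat n A q)"
    using A P Q
    by (subst add_mult_distrib_mat[of _ n n _ _ n]) auto
  then show ?case
    using A P Q
    by (simp add: poly_at_mat_pCons poly_at_mat_add poly_at_mat_smult pCons(2) zero_smult_add_mat)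
qed

lemma poly_at_mat_commutes: "A * poly_at_mat n A p = poly_at_mat n A p * A"
proof -
  have X: "poly_at_mat n A [:0, 1:] = A"
    using A by (simp add: poly_at_mat_pCons poly_at_mat_0 zero_smult_add_mat
        mult_smult_distrib[of _ n n _ n] smult_one_mat)
  show ?thesis
    using poly_at_mat_mult[of "[:0, 1:]" p] poly_at_mat_mult[of p "[:0, 1:]"]
    unfolding X by (simp add: mult.commute)
qed

lemma poly_at_mat_monom: "poly_at_mat n A (monom c j) = c \<cdot>\<^sub>m (A ^\<^sub>m j)"
proof (induct j)
  case 0
  show ?case using A by (simp add: monom_0 poly_at_mat_pCons poly_at_mat_0)
next
  case (Suc j)
  show ?case
    using A pow_carrier_mat[OF A, of j] mult_carrier_mat[OF pow_carrier_mat[OF A, of j] A] poly_at_mat_carrier[of "monom c j"]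
      poly_at_mat_commutes[of "monom c j"] 
    by (simp add: monom_Suc poly_at_mat_pCons Suc mult_smult_assoc_mat[of _ n n _ n] zero_smult_add_mat)
qed

lemma poly_at_mat_sum_monom_index:
  assumes "i < n" "k < n"
  shows "poly_at_mat n A (\<Sum>j<N. monom (c j) j) $$ (i, k) = (\<Sum>j<N. (A ^\<^sub>m j) $$ (i, k) * c j)"
proof (induct N)
  case 0
  show ?case using assms by (simp add: poly_at_mat_0)
next
  case (Suc N)
  then show ?case
    using assms pow_carrier_mat[OF A, of N] poly_at_mat_carrier[of "\<Sum>j<N. monom (c j) j"]
      carrier_matD[OF pow_carrier_mat[OF A, of N]]
    by (simp add: poly_at_mat_add poly_at_mat_monom)
qed

end

section \<open>Underdetermined linear systems\<close>

text \<open>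
  Filled up with zero rows, the coefficients form a square matrix that has a left kernel vector,
  hence a right one.
\<close>

lemma underdetermined_system:
  fixes f :: "nat \<Rightarrow> nat \<Rightarrow> real"
  assumes "m < N"
  shows "\<exists>c. (\<exists>j<N. c j \<noteq> 0) \<and> (\<forall>k<m. (\<Sum>j<N. f k j * c j) = 0)"
proof -
  let ?F = "mat N N (\<lambda>(k, j). if k < m then f k j else 0)"
  have F: "?F \<in> carrier_mat N N" by simp
  have "?F\<^sup>T *\<^sub>v unit_vec N m = 0\<^sub>v N"
    using assms by (intro eq_vecI) auto
  moreover have "unit_vec N m \<noteq> (0\<^sub>v N :: real vec)"
    using assms by simp
  ultimately have "det ?F\<^sup>T = 0"
    using det_0_iff_vec_prod_zero_field[OF transpose_carrier_mat[THEN iffD2, OF F]] unit_vec_carrier[of N m]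
    by blast
  then have "det ?F = 0"
    by (simp add: det_transpose[OF F])
  then obtain v where v: "v \<in> carrier_vec N" "v \<noteq> 0\<^sub>v N" "?F *\<^sub>v v = 0\<^sub>v N"
    using det_0_iff_vec_prod_zero_field[OF F] by auto
  have "\<exists>j<N. v $ j \<noteq> 0"
    using v(1,2) by (auto simp: vec_eq_iff)
  moreover have "(\<Sum>j<N. f k j * v $ j) = 0" if "k < m" for k
  proof -
    have "(?F *\<^sub>v v) $ k = (\<Sum>j<N. f k j * v $ j)"
      using that assms v(1) by (simp add: scalar_prod_def lessThan_atLeast0)
    then show ?thesis using v(3) that assms by simp
  qed
  ultimately show ?thesis by (intro exI[of _ "\<lambda>j. v $ j"]) auto
qed

lemma ex_vec_orthogonal_pair:
  assumes "n \<ge> 3" "a \<in> carrier_vec n" "b \<in> carrier_vec n"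
  shows "\<exists>z \<in> carrier_vec n. z \<noteq> 0\<^sub>v n \<and> z \<bullet> a = 0 \<and> z \<bullet> (b :: real vec) = 0"
proof -
  obtain c :: "nat \<Rightarrow> real" where c: "\<exists>j<n. c j \<noteq> 0"
    "\<forall>k<2::nat. (\<Sum>j<n. (if k = 0 then a $ j else b $ j) * c j) = 0"
    using underdetermined_system[of 2 n "\<lambda>k j. if k = 0 then a $ j else b $ j"] assms(1) by auto
  have "vec n c \<bullet> a = 0" "vec n c \<bullet> b = 0"
    using spec[OF c(2), of 0] spec[OF c(2), of 1] assms(2,3)
    by (simp_all add: scalar_prod_def lessThan_atLeast0 mult.commute)
  moreover have "vec n c \<noteq> 0\<^sub>v n"
    using c(1) by (auto simp: vec_eq_iff)
  ultimately show ?thesis by (intro bexI[of _ "vec n c"]) auto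
qed

section \<open>A complex structure commuting with a matrix without real eigenvalues\<close>

text \<open>
  Any \<open>n\<^sup>2 + 1\<close> matrices are linearly dependent, in particular the first powers of \<open>A\<close>. The entry at
  \<open>(i, k)\<close> gives the equation number \<open>i * n + k\<close>.
\<close>

lemma ex_annihilating_poly:
  fixes A :: "real mat"
  assumes A: "A \<in> carrier_mat n n"
  shows "\<exists>p. p \<noteq> 0 \<and> poly_at_mat n A p = 0\<^sub>m n n"
proof -
  obtain c where c: "\<exists>j<n * n + 1. c j \<noteq> 0"
    "\<forall>k<n * n. (\<Sum>j<n * n + 1. (A ^\<^sub>m j) $$ (k div n, k mod n) * c j) = 0"
    using underdetermined_system[of "n * n" "n * n + 1" "\<lambda>k j. (A ^\<^sub>m j) $$ (k div n, k mod n)"]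
      less_add_one[of "n * n"] by blast
  let ?p = "\<Sum>j<n * n + 1. monom (c j) j"
  have "coeff ?p j = c j" if "j < n * n + 1" for j
    using that by (simp add: coeff_sum del: sum.lessThan_Suc)
  then have "?p \<noteq> 0" using c(1) by (metis coeff_0)
  moreover have "poly_at_mat n A ?p = 0\<^sub>m n n"
  proof (rule eq_matI)
    fix i k assume "i < dim_row (0\<^sub>m n n :: real mat)" "k < dim_col (0\<^sub>m n n :: real mat)"
    then have ik: "i < n" "k < n" by auto
    have "i * n + k < Suc i * n" using ik by simp
    also have "\<dots> \<le> n * n" using ik by (intro mult_right_mono) auto
    finally have "(\<Sum>j<n * n + 1. (A ^\<^sub>m j) $$ (i, k) * c j) = 0"
      using c(2)[rule_format, of "i * n + k"] ik by simp
    then show "poly_at_mat n A ?p $$ (i, k) = 0\<^sub>m n n $$ (i, k)"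
      using ik poly_at_mat_sum_monom_index[OF A ik] by (simp del: sum.lessThan_Suc)
  qed (use poly_at_mat_carrier[OF A] in auto)
  ultimately show ?thesis by blast
qed

text \<open>
  If \<open>c\<close> annihilates \<open>A\<close> with minimal degree and \<open>c = (X - r) q\<close>, then the columns of \<open>q(A)\<close> lie in the
  kernel of \<open>A - r\<close>, which is trivial; so \<open>q\<close> annihilates \<open>A\<close>, contrary to minimality. Hence \<open>c\<close> has no
  real root, and any \<open>g\<close> such that \<open>c\<close> divides \<open>g\<^sup>2 + 1\<close> yields \<open>J = g(A)\<close>.
\<close>

lemma ex_commuting_complex_structure:
  fixes A :: "real mat"
  assumes A: "A \<in> carrier_mat n n"
    and no_eigenvalue: "\<And>r x. \<lbrakk>x \<in> carrier_vec n; A *\<^sub>v x = r \<cdot>\<^sub>v x\<rbrakk> \<Longrightarrow> x = 0\<^sub>v n"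
  shows "\<exists>J \<in> carrier_mat n n. A * J = J * A \<and> J * J = (- 1) \<cdot>\<^sub>m 1\<^sub>m n"
proof -
  note PC = poly_at_mat_carrier[OF A]
  define c where "c = (ARG_MIN degree p. p \<noteq> 0 \<and> poly_at_mat n A p = 0\<^sub>m n n)"
  obtain p0 where "p0 \<noteq> 0 \<and> poly_at_mat n A p0 = 0\<^sub>m n n"
    using ex_annihilating_poly[OF A] by auto
  then have c: "c \<noteq> 0" "poly_at_mat n A c = 0\<^sub>m n n"
    and c_min: "\<And>p. \<lbrakk>p \<noteq> 0; poly_at_mat n A p = 0\<^sub>m n n\<rbrakk> \<Longrightarrow> degree c \<le> degree p"
    using arg_min_nat_lemma[of "\<lambda>p. p \<noteq> 0 \<and> poly_at_mat n A p = 0\<^sub>m n n" p0 degree]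
    unfolding c_def by auto
  have "poly c r \<noteq> 0" for r
  proof
    assume "poly c r = 0"
    then obtain q where q: "c = [:- r, 1:] * q"
      by (auto simp: poly_eq_0_iff_dvd)
    have q0: "q \<noteq> 0" using c(1) q by auto
    have "poly_at_mat n A q = 0\<^sub>m n n"
    proof (rule eq_matI)
      fix i k assume "i < dim_row (0\<^sub>m n n :: real mat)" "k < dim_col (0\<^sub>m n n :: real mat)"
      then have ik: "i < n" "k < n" by auto
      let ?x = "poly_at_mat n A q *\<^sub>v unit_vec n k"
      have x: "?x \<in> carrier_vec n" by (rule mult_mat_vec_carrier[OF PC unit_vec_carrier])
      have "c = smult (- r) q + pCons 0 q"
        unfolding q by simp
      then have "poly_at_mat n A (smult (- r) q + pCons 0 q) = 0\<^sub>m n n"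
        using c(2) by simp
      then have "0\<^sub>m n n = (- r) \<cdot>\<^sub>m poly_at_mat n A q + A * poly_at_mat n A q"
        unfolding poly_at_mat_add[OF A] poly_at_mat_smult[OF A] poly_at_mat_pCons[OF A]
        using A PC[of q] by (simp add: zero_smult_add_mat)
      then have "0\<^sub>v n = ((- r) \<cdot>\<^sub>m poly_at_mat n A q + A * poly_at_mat n A q) *\<^sub>v unit_vec n k"
        by (metis zero_mult_mat_vec unit_vec_carrier zero_carrier_mat)
      also have "\<dots> = (- r) \<cdot>\<^sub>v ?x + A *\<^sub>v ?x"
        using A PC[of q] by (subst add_mult_distrib_mat_vec[of _ n n]) (auto simp: smult_mat_mult_vec)
      finally have e: "0\<^sub>v n = (- r) \<cdot>\<^sub>v ?x + A *\<^sub>v ?x" .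
      have "A *\<^sub>v ?x = r \<cdot>\<^sub>v ?x"
      proof (rule eq_vecI)
        fix j assume "j < dim_vec (r \<cdot>\<^sub>v ?x)"
        then have "j < n" using PC[of q] by simp
        then show "(A *\<^sub>v ?x) $ j = (r \<cdot>\<^sub>v ?x) $ j"
          using arg_cong[OF e, of "\<lambda>v. v $ j"] x A PC[of q]
          by (simp del: index_mult_mat_vec)
      qed (use A PC[of q] in auto)
      then have "?x = 0\<^sub>v n" using no_eigenvalue x by blast
      moreover have "?x $ i = poly_at_mat n A q $$ (i, k)"
        using ik PC[of q] by simp
      ultimately show "poly_at_mat n A q $$ (i, k) = 0\<^sub>m n n $$ (i, k)"
        using ik by simp
    qed (use PC[of q] in auto)
    then have "degree c \<le> degree q" using c_min q0 by blast
    moreover have "degree c = 1 + degree q"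
      unfolding q using q0 by (subst degree_mult_eq) auto
    ultimately show False by simp
  qed
  then obtain g where "c dvd g * g + 1"
    using real_poly_without_roots_dvd_square_plus_one by blast
  then obtain h where h: "g * g + 1 = c * h" by (auto elim: dvdE)
  let ?J = "poly_at_mat n A g"
  have "poly_at_mat n A (g * g + 1) = 0\<^sub>m n n"
    unfolding h using c(2) PC[of h] by (simp add: poly_at_mat_mult[OF A])
  moreover have "poly_at_mat n A 1 = 1\<^sub>m n"
    using poly_at_mat_monom[OF A, of 1 0] A by (simp add: smult_one_mat)
  ultimately have e: "?J * ?J + 1\<^sub>m n = 0\<^sub>m n n"
    by (simp add: poly_at_mat_add[OF A] poly_at_mat_mult[OF A])
  have "?J * ?J = (- 1) \<cdot>\<^sub>m 1\<^sub>m n"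
  proof (rule eq_matI)
    fix i j assume "i < dim_row ((- 1) \<cdot>\<^sub>m 1\<^sub>m n :: real mat)" "j < dim_col ((- 1) \<cdot>\<^sub>m 1\<^sub>m n :: real mat)"
    then show "(?J * ?J) $$ (i, j) = ((- 1) \<cdot>\<^sub>m 1\<^sub>m n) $$ (i, j)"
      using arg_cong[OF e, of "\<lambda>M. M $$ (i, j)"] PC[of g]
      by (simp del: index_mult_mat(1))
  qed (use PC[of g] in auto)
  then show ?thesis
    using poly_at_mat_commutes[OF A] PC by blast
qed

section \<open>Rank one matrices\<close>

definition outer :: "real vec \<Rightarrow> real vec \<Rightarrow> real mat" where
  "outer x y = mat (dim_vec x) (dim_vec y) (\<lambda>(i, j). x $ i * y $ j)"

lemma outer_carrier: "x \<in> carrier_vec n \<Longrightarrow> y \<in> carrier_vec n \<Longrightarrow> outer x y \<in> carrier_mat n n"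
  by (simp add: outer_def)

lemma outer_index: "i < dim_vec x \<Longrightarrow> j < dim_vec y \<Longrightarrow> outer x y $$ (i, j) = x $ i * y $ j"
  by (simp add: outer_def)

lemma mult_outer:
  assumes "M \<in> carrier_mat n n" "x \<in> carrier_vec n" "y \<in> carrier_vec n"
  shows "M * outer x y = outer (M *\<^sub>v x) y"
  using assms
  by (intro eq_matI) (auto simp: outer_def scalar_prod_def sum_distrib_left mult_ac)

lemma outer_mult:
  assumes "M \<in> carrier_mat n n" "x \<in> carrier_vec n" "y \<in> carrier_vec n"
  shows "outer x y * M = outer x (M\<^sup>T *\<^sub>v y)"
  using assms
  by (intro eq_matI) (auto simp: outer_def scalar_prod_def sum_distrib_left mult_ac)

lemma outer_mult_vec:
  assumes "x \<in> carrier_vec n" "y \<in> carrier_vec n" "v \<in> carrier_vec n"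
  shows "outer x y *\<^sub>v v = (y \<bullet> v) \<cdot>\<^sub>v x"
  using assms
  by (intro eq_vecI) (auto simp: outer_def scalar_prod_def sum_distrib_left mult_ac)

lemma outer_smult: "outer (c \<cdot>\<^sub>v x) y = c \<cdot>\<^sub>m outer x y" "outer x (c \<cdot>\<^sub>v y) = c \<cdot>\<^sub>m outer x y"
  by (auto simp: outer_def intro!: eq_matI)

lemma outer_mult_outer:
  assumes "x \<in> carrier_vec n" "y \<in> carrier_vec n" "z \<in> carrier_vec n" "w \<in> carrier_vec n"
  shows "outer x y * outer z w = (y \<bullet> z) \<cdot>\<^sub>m outer x w"
  using assms mult_outer[of "outer x y" n z w]
  by (simp add: outer_carrier outer_mult_vec outer_smult)

lemma vec_nonzero_index:
  assumes "x \<in> carrier_vec n" "x \<noteq> 0\<^sub>v n"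
  obtains i where "i < n" "x $ i \<noteq> 0"
  using assms by (auto simp: vec_eq_iff)

lemma real_vec_self_scalar_prod_eq_0:
  fixes w :: "real vec"
  assumes "w \<in> carrier_vec n" "w \<bullet> w = 0"
  shows "w = 0\<^sub>v n"
  using assms by (intro eq_vecI) (auto simp: scalar_prod_def sum_nonneg_eq_0_iff)

lemma outer_nonzero:
  assumes "x \<in> carrier_vec n" "y \<in> carrier_vec n" "x \<noteq> 0\<^sub>v n" "y \<noteq> 0\<^sub>v n"
  shows "outer x y \<noteq> 0\<^sub>m n n"
proof -
  obtain i j where "i < n" "x $ i \<noteq> 0" "j < n" "y $ j \<noteq> 0"
    using assms by (meson vec_nonzero_index)
  then have "outer x y $$ (i, j) \<noteq> 0\<^sub>m n n $$ (i, j)"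
    using assms(1,2) by (simp add: outer_index)
  then show ?thesis by metis
qed

section \<open>Nonscalar matrices\<close>

definition nonscalar :: "nat \<Rightarrow> real mat \<Rightarrow> bool" where
  "nonscalar n M \<longleftrightarrow> M \<in> carrier_mat n n \<and> (\<forall>c. M \<noteq> c \<cdot>\<^sub>m 1\<^sub>m n)"

lemma scalar_mat_mult:
  fixes M :: "real mat"
  assumes "M \<in> carrier_mat n n"
  shows "(c \<cdot>\<^sub>m 1\<^sub>m n) * M = c \<cdot>\<^sub>m M" "M * (c \<cdot>\<^sub>m 1\<^sub>m n) = c \<cdot>\<^sub>m M"
  using assms by (simp_all add: mult_smult_assoc_mat[of _ n n _ n] mult_smult_distrib[of _ n n _ n])

lemma scalar_mat_mult_vec: "v \<in> carrier_vec n \<Longrightarrow> (c \<cdot>\<^sub>m 1\<^sub>m n) *\<^sub>v v = c \<cdot>\<^sub>v (v :: real vec)"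
  using smult_mat_mult_vec[of "1\<^sub>m n" n v c] by simp

text \<open>
  Commuting with the matrix unit at \<open>(a, 0)\<close> and comparing the entries at \<open>(i, 0)\<close> determines \<open>M\<close>.
\<close>

lemma central_imp_scalar:
  fixes M :: "real mat"
  assumes M: "M \<in> carrier_mat n n" and central: "\<And>B. B \<in> carrier_mat n n \<Longrightarrow> M * B = B * M"
  shows "M = (M $$ (0, 0)) \<cdot>\<^sub>m 1\<^sub>m n"
proof (rule eq_matI)
  fix i a assume "i < dim_row ((M $$ (0, 0)) \<cdot>\<^sub>m 1\<^sub>m n)" "a < dim_col ((M $$ (0, 0)) \<cdot>\<^sub>m 1\<^sub>m n)"
  then have ia: "i < n" "a < n" "0 < n" by auto
  let ?E = "outer (unit_vec n a) (unit_vec n 0)"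
  have "M * ?E = ?E * M"
    by (intro central outer_carrier) auto
  then have "outer (M *\<^sub>v unit_vec n a) (unit_vec n 0) = outer (unit_vec n a) (M\<^sup>T *\<^sub>v unit_vec n 0)"
    using M by (simp add: mult_outer outer_mult)
  then have "outer (M *\<^sub>v unit_vec n a) (unit_vec n 0) $$ (i, 0)
      = outer (unit_vec n a) (M\<^sup>T *\<^sub>v unit_vec n 0) $$ (i, 0)"
    by simp
  then show "M $$ (i, a) = ((M $$ (0, 0)) \<cdot>\<^sub>m 1\<^sub>m n) $$ (i, a)"
    using ia M by (auto simp: outer_index split: if_splits)
qed (use M in auto)

lemma nonscalarI:
  assumes M: "M \<in> carrier_mat n n" "M \<noteq> 0\<^sub>m n n"
    and x: "x \<in> carrier_vec n" "x \<noteq> 0\<^sub>v n" "M *\<^sub>v x = 0\<^sub>v n"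
  shows "nonscalar n M"
  unfolding nonscalar_def
proof (intro conjI allI notI)
  fix c assume c: "M = c \<cdot>\<^sub>m 1\<^sub>m n"
  obtain i where i: "i < n" "x $ i \<noteq> 0" using x vec_nonzero_index by blast
  have "c \<cdot>\<^sub>v x = 0\<^sub>v n" using x c by (simp add: scalar_mat_mult_vec)
  then have "(c \<cdot>\<^sub>v x) $ i = 0" using i by simp
  then have "c = 0" using i x(1) by simp
  then have "M = 0\<^sub>m n n" using c by (auto intro!: eq_matI)
  then show False using M by simp
qed fact

lemma nonscalar_outer:
  assumes "n \<ge> 3" and xy: "x \<in> carrier_vec n" "y \<in> carrier_vec n" "x \<noteq> 0\<^sub>v n" "y \<noteq> 0\<^sub>v n"
  shows "nonscalar n (outer x y)"
proof -
  obtain z where z: "z \<in> carrier_vec n" "z \<noteq> 0\<^sub>v n" "z \<bullet> y = 0"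
    using ex_vec_orthogonal_pair[OF assms(1) xy(2) xy(2)] by auto
  then have "outer x y *\<^sub>v z = 0\<^sub>v n"
    using xy comm_scalar_prod[OF z(1) xy(2)] by (simp add: outer_mult_vec) (auto intro!: eq_vecI)
  then show ?thesis
    using xy z by (intro nonscalarI[of _ n z] outer_carrier outer_nonzero) auto
qed

text \<open>
  The left eigenvector \<open>y\<close> belongs to the same eigenvalue \<open>r\<close>, because \<open>A - r\<close> and its transpose have
  the same determinant. Then both products with \<open>A - r\<close> vanish.
\<close>

lemma real_eigenvalue_commutes_outer:
  assumes A: "A \<in> carrier_mat n n" and x: "x \<in> carrier_vec n" "x \<noteq> 0\<^sub>v n" "A *\<^sub>v x = r \<cdot>\<^sub>v x"
  shows "\<exists>y \<in> carrier_vec n. y \<noteq> 0\<^sub>v n \<and> A * outer x y = outer x y * A"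
proof -
  let ?M = "A + (- r) \<cdot>\<^sub>m 1\<^sub>m n"
  have M: "?M \<in> carrier_mat n n" using A by simp
  have "?M *\<^sub>v x = 0\<^sub>v n"
    using A x by (simp add: add_mult_distrib_mat_vec[of _ n n] scalar_mat_mult_vec) (auto intro!: eq_vecI)
  then have "det ?M = 0"
    using det_0_iff_vec_prod_zero_field[OF M] x by blast
  then have "det ?M\<^sup>T = 0"
    by (simp add: det_transpose[OF M])
  then obtain y where y: "y \<in> carrier_vec n" "y \<noteq> 0\<^sub>v n" "?M\<^sup>T *\<^sub>v y = 0\<^sub>v n"
    using det_0_iff_vec_prod_zero_field[OF transpose_carrier_mat[THEN iffD2, OF M]] by blast
  have "?M * outer x y = outer x y * ?M"
    unfolding mult_outer[OF M x(1) y(1)] outer_mult[OF M x(1) y(1)] y(3) \<open>?M *\<^sub>v x = 0\<^sub>v n\<close>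
    using x y by (auto simp: outer_def intro!: eq_matI)
  then have e: "A * outer x y + (- r) \<cdot>\<^sub>m outer x y = outer x y * A + (- r) \<cdot>\<^sub>m outer x y"
    using A outer_carrier[OF x(1) y(1)]
    by (simp add: add_mult_distrib_mat[of _ n n _ _ n] mult_add_distrib_mat[of _ n n _ n]
        scalar_mat_mult)
  have "A * outer x y = outer x y * A"
  proof (rule eq_matI)
    fix i j assume "i < dim_row (outer x y * A)" "j < dim_col (outer x y * A)"
    then show "(A * outer x y) $$ (i, j) = (outer x y * A) $$ (i, j)"
      using arg_cong[OF e, of "\<lambda>M. M $$ (i, j)"] A outer_carrier[OF x(1) y(1)]
      by (simp del: index_mult_mat(1))
  qed (use A outer_carrier[OF x(1) y(1)] in auto)
  then show ?thesis using y by blast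
qed

section \<open>Complex structures and matrices of complex rank one\<close>

text \<open>
  The map \<open>v \<mapsto> (w\<^sup>T v) z - (w\<^sup>T J v) J z\<close>. With \<open>J\<close> as multiplication by the imaginary unit it is
  complex linear with image spanned by \<open>z\<close>, so it is the complex counterpart of \<open>z w\<^sup>T\<close>. It equals
  \<open>X - J X J\<close> for \<open>X = z w\<^sup>T\<close>.
\<close>

definition complex_outer :: "real mat \<Rightarrow> real vec \<Rightarrow> real vec \<Rightarrow> real mat" where
  "complex_outer J z w = outer z w + outer (J *\<^sub>v z) ((- 1) \<cdot>\<^sub>v (J\<^sup>T *\<^sub>v w))"

context
  fixes n :: nat and J :: "real mat"
  assumes J: "J \<in> carrier_mat n n" and JJ: "J * J = (- 1) \<cdot>\<^sub>m 1\<^sub>m n"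
begin

lemma complex_structure_twice:
  assumes "x \<in> carrier_vec n"
  shows "J *\<^sub>v (J *\<^sub>v x) = (- 1) \<cdot>\<^sub>v x"
  using J assms by (simp add: assoc_mult_mat_vec[symmetric] JJ scalar_mat_mult_vec)

lemma complex_structure_transpose_twice:
  assumes "x \<in> carrier_vec n"
  shows "J\<^sup>T *\<^sub>v (J\<^sup>T *\<^sub>v x) = (- 1) \<cdot>\<^sub>v x"
proof -
  have "J\<^sup>T * J\<^sup>T = (J * J)\<^sup>T" using J by (simp add: transpose_mult)
  also have "\<dots> = (- 1) \<cdot>\<^sub>m 1\<^sub>m n" unfolding JJ by (auto intro!: eq_matI)
  finally have "J\<^sup>T * J\<^sup>T = (- 1) \<cdot>\<^sub>m 1\<^sub>m n" .
  then show ?thesis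
    using J assms by (simp add: assoc_mult_mat_vec[symmetric] scalar_mat_mult_vec)
qed

text \<open>
  Applying \<open>J\<close> to the relation gives a second one, and together they imply \<open>(a\<^sup>2 + b\<^sup>2) x = 0\<close>.
\<close>

lemma complex_structure_independent:
  assumes x: "x \<in> carrier_vec n" "x \<noteq> 0\<^sub>v n"
    and e: "a \<cdot>\<^sub>v x + b \<cdot>\<^sub>v (J *\<^sub>v x) = 0\<^sub>v n"
  shows "a = 0 \<and> b = 0"
proof -
  obtain i where i: "i < n" "x $ i \<noteq> 0" using x vec_nonzero_index by blast
  have Jx: "J *\<^sub>v x \<in> carrier_vec n" using J x by simp
  have "J *\<^sub>v (a \<cdot>\<^sub>v x + b \<cdot>\<^sub>v (J *\<^sub>v x)) = a \<cdot>\<^sub>v (J *\<^sub>v x) + (- b) \<cdot>\<^sub>v x"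
    using J x Jx
    by (simp add: mult_add_distrib_mat_vec[of _ n n] mult_mat_vec[of _ n n] complex_structure_twice
        smult_smult_assoc)
  also have "J *\<^sub>v (a \<cdot>\<^sub>v x + b \<cdot>\<^sub>v (J *\<^sub>v x)) = 0\<^sub>v n"
    unfolding e using J by (rule mult_mat_zero_vec)
  finally have e': "0\<^sub>v n = a \<cdot>\<^sub>v (J *\<^sub>v x) + (- b) \<cdot>\<^sub>v x" .
  define s t where "s = x $ i" and "t = (J *\<^sub>v x) $ i"
  have 1: "a * s + b * t = 0"
    using arg_cong[OF e, of "\<lambda>v. v $ i"] i x(1) Jx J unfolding s_def t_def by (simp del: index_mult_mat_vec)
  have 2: "a * t - b * s = 0"
    using arg_cong[OF e', of "\<lambda>v. v $ i"] i x(1) Jx J unfolding s_def t_def by (simp del: index_mult_mat_vec)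
  have "(a * a + b * b) * s = a * (a * s + b * t) - b * (a * t - b * s)"
    by (simp add: algebra_simps)
  then have "a * a + b * b = 0" using 1 2 i s_def by simp
  then show ?thesis by (simp add: sum_squares_eq_zero_iff)
qed

context
  fixes z w :: "real vec"
  assumes z: "z \<in> carrier_vec n" and w: "w \<in> carrier_vec n"
begin

lemma complex_outer_closed:
  "J *\<^sub>v z \<in> carrier_vec n" "J\<^sup>T *\<^sub>v w \<in> carrier_vec n" "complex_outer J z w \<in> carrier_mat n n"
  using J z w by (auto simp: complex_outer_def intro!: outer_carrier add_carrier_mat mult_mat_vec_carrier)

lemma complex_outer_commutes: "J * complex_outer J z w = complex_outer J z w * J"
proof -
  have "J * complex_outer J z w = outer (J *\<^sub>v z) w + outer z (J\<^sup>T *\<^sub>v w)"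
    using J z w complex_outer_closed
    by (simp add: complex_outer_def mult_add_distrib_mat[of _ n n _ n] outer_carrier mult_outer[of _ n]
        complex_structure_twice outer_smult smult_smult_mat
        mult_smult_distrib[of _ n n _ n] smult_one_mat)
  moreover have "complex_outer J z w * J = outer z (J\<^sup>T *\<^sub>v w) + outer (J *\<^sub>v z) w"
    using J z w complex_outer_closed
    by (simp add: complex_outer_def add_mult_distrib_mat[of _ n n _ _ n] outer_carrier outer_mult[of _ n]
        complex_structure_transpose_twice outer_smult mult_mat_vec[of _ n n] smult_smult_mat
        mult_smult_assoc_mat[of _ n n _ n] smult_one_mat)
  ultimately show ?thesis
    using z w complex_outer_closed by (simp add: comm_add_mat[of _ n n] outer_carrier)
qed

lemma complex_outer_mult_vec:
  assumes v: "v \<in> carrier_vec n"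
  shows "complex_outer J z w *\<^sub>v v = (w \<bullet> v) \<cdot>\<^sub>v z + (- (w \<bullet> (J *\<^sub>v v))) \<cdot>\<^sub>v (J *\<^sub>v z)"
proof -
  have "(J\<^sup>T *\<^sub>v w) \<bullet> v = w \<bullet> (J *\<^sub>v v)"
    using transpose_vec_mult_scalar[OF J v w] by simp
  then show ?thesis
    using z w v complex_outer_closed
    by (simp add: complex_outer_def add_mult_distrib_mat_vec[of _ n n] outer_carrier outer_mult_vec[of _ n])
qed

text \<open>
  The image of \<open>w\<close> itself has the nonzero coefficient \<open>w\<^sup>T w\<close> at \<open>z\<close>.
\<close>

lemma complex_outer_nonzero:
  assumes "z \<noteq> 0\<^sub>v n" "w \<noteq> 0\<^sub>v n"
  shows "complex_outer J z w \<noteq> 0\<^sub>m n n"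
proof
  assume "complex_outer J z w = 0\<^sub>m n n"
  then have "(w \<bullet> w) \<cdot>\<^sub>v z + (- (w \<bullet> (J *\<^sub>v w))) \<cdot>\<^sub>v (J *\<^sub>v z) = 0\<^sub>v n"
    using complex_outer_mult_vec[OF w] w by (simp add: zero_mult_mat_vec)
  then have "w \<bullet> w = 0"
    using complex_structure_independent[OF z assms(1)] by blast
  then show False using w assms(2) using real_vec_self_scalar_prod_eq_0 by blast
qed

lemma nonscalar_complex_outer:
  assumes "z \<noteq> 0\<^sub>v n" "w \<noteq> 0\<^sub>v n" and x: "x \<in> carrier_vec n" "x \<noteq> 0\<^sub>v n"
    and "w \<bullet> x = 0" "w \<bullet> (J *\<^sub>v x) = 0"
  shows "complex_outer J z w *\<^sub>v x = 0\<^sub>v n" "nonscalar n (complex_outer J z w)"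
proof -
  show 1: "complex_outer J z w *\<^sub>v x = 0\<^sub>v n"
    unfolding complex_outer_mult_vec[OF x(1)] assms(5,6)
    using z J by (auto intro!: eq_vecI simp del: index_mult_mat_vec)
  show "nonscalar n (complex_outer J z w)"
    by (rule nonscalarI[OF complex_outer_closed(3) complex_outer_nonzero[OF assms(1,2)] x 1])
qed

end

end

section \<open>Matrices commuting with two given ones\<close>

lemma commutes_scaled_sum:
  fixes A M N :: "real mat"
  assumes "A \<in> carrier_mat n n" "M \<in> carrier_mat n n" "N \<in> carrier_mat n n"
    and "A * M = M * A" "A * N = N * A"
  shows "A * (a \<cdot>\<^sub>m M + b \<cdot>\<^sub>m N) = (a \<cdot>\<^sub>m M + b \<cdot>\<^sub>m N) * A"
  using assms
  by (simp add: add_mult_distrib_mat[of _ n n _ _ n] mult_add_distrib_mat[of _ n n _ n]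
      mult_smult_distrib[of _ n n _ n] mult_smult_assoc_mat[of _ n n _ n])

context
  fixes n :: nat and J K :: "real mat" and \<tau> :: real
  assumes n: "n \<ge> 3" and J: "J \<in> carrier_mat n n" and JJ: "J * J = (- 1) \<cdot>\<^sub>m 1\<^sub>m n"
    and K: "K \<in> carrier_mat n n" and KK: "K * K = \<tau> \<cdot>\<^sub>m 1\<^sub>m n" and JK: "J * K = (- 1) \<cdot>\<^sub>m (K * J)"
begin

lemma anticommuting_mult_left:
  assumes "M \<in> carrier_mat n n"
  shows "J * (J * M) = (- 1) \<cdot>\<^sub>m M" "K * (K * M) = \<tau> \<cdot>\<^sub>m M" "J * (K * M) = (- 1) \<cdot>\<^sub>m (K * (J * M))"
proof -
  show "J * (J * M) = (- 1) \<cdot>\<^sub>m M" "K * (K * M) = \<tau> \<cdot>\<^sub>m M"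
    using J K assms by (simp_all add: assoc_mult_mat[of _ n n _ n _ n, symmetric] JJ KK scalar_mat_mult)
  have "J * (K * M) = (J * K) * M" using J K assms by (simp add: assoc_mult_mat[of _ n n _ n _ n])
  also have "\<dots> = (- 1) \<cdot>\<^sub>m (K * (J * M))"
    unfolding JK using J K assms
    by (simp add: assoc_mult_mat[of _ n n _ n _ n] mult_smult_assoc_mat[of _ n n _ n])
  finally show "J * (K * M) = (- 1) \<cdot>\<^sub>m (K * (J * M))" .
qed

text \<open>
  Moving \<open>J\<close> past the two factors \<open>K\<close> changes the sign twice.
\<close>

lemma sandwich_commutes:
  assumes W: "W \<in> carrier_mat n n" "J * W = W * J"
  shows "J * (K * (W * K)) = (K * (W * K)) * J"
proof -
  note assoc = assoc_mult_mat[of _ n n _ n _ n]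
  note smult = mult_smult_distrib[of _ n n _ n] mult_smult_assoc_mat[of _ n n _ n] smult_smult_mat
  have "J * (K * (W * K)) = (- 1) \<cdot>\<^sub>m (K * ((J * W) * K))"
    using J K W(1) by (simp add: anticommuting_mult_left assoc)
  also have "\<dots> = (- 1) \<cdot>\<^sub>m (K * (W * (J * K)))"
    unfolding W(2) using J K W(1) by (simp add: assoc)
  also have "\<dots> = (K * (W * K)) * J"
    unfolding JK using J K W(1) by (simp add: assoc smult smult_one_mat)
  finally show ?thesis .
qed

lemma ex_nonscalar_commuting_with_kernel:
  "\<exists>W x. nonscalar n W \<and> J * W = W * J \<and> x \<in> carrier_vec n \<and> x \<noteq> 0\<^sub>v n \<and> W *\<^sub>v x = 0\<^sub>v n"
proof -
  let ?x = "unit_vec n 0 :: real vec"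
  have x: "?x \<in> carrier_vec n" "?x \<noteq> 0\<^sub>v n" "J *\<^sub>v ?x \<in> carrier_vec n"
    using n J by auto
  obtain w where w: "w \<in> carrier_vec n" "w \<noteq> 0\<^sub>v n" "w \<bullet> ?x = 0" "w \<bullet> (J *\<^sub>v ?x) = 0"
    using ex_vec_orthogonal_pair[OF n x(1) x(3)] by blast
  let ?W = "complex_outer J ?x w"
  note W = complex_outer_closed(3)[OF J JJ x(1) w(1)]
    complex_outer_commutes[OF J JJ x(1) w(1)]
    nonscalar_complex_outer[OF J JJ x(1) w(1) x(2) w(2) x(1,2) w(3,4)]
  show ?thesis
    using W x by blast
qed

text \<open>
  \<open>Z(W) = \<tau> W + K W K\<close> commutes with \<open>J\<close> and \<open>K\<close> whenever \<open>W\<close> commutes with \<open>J\<close>; up to a factor it averages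
  \<open>W\<close> over conjugation by \<open>K\<close>. It is applied to a noninjective \<open>W\<close> and to \<open>J W\<close>. If both \<open>Z(W) = c\<close> and
  \<open>Z(J W) = d\<close> were scalar, then \<open>2 \<tau> J W = J Z(W) + Z(J W) = c J + d\<close>, because \<open>K J W K = - J K W K\<close>. On a
  kernel vector of \<open>W\<close> this forces \<open>c = d = 0\<close>, and then \<open>W = 0\<close>.
\<close>

lemma anticommuting_invertible_common_commutant:
  assumes "\<tau> \<noteq> 0"
  shows "\<exists>Z. nonscalar n Z \<and> J * Z = Z * J \<and> K * Z = Z * K"
proof -
  note assoc = assoc_mult_mat[of _ n n _ n _ n]
  note smult = mult_smult_distrib[of _ n n _ n] mult_smult_assoc_mat[of _ n n _ n] smult_smult_mat
  obtain W x where W: "W \<in> carrier_mat n n" "J * W = W * J" "W *\<^sub>v x = 0\<^sub>v n" "nonscalar n W"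
    and x: "x \<in> carrier_vec n" "x \<noteq> 0\<^sub>v n"
    using ex_nonscalar_commuting_with_kernel unfolding nonscalar_def by blast
  have Jx: "J *\<^sub>v x \<in> carrier_vec n" using J x by simp
  let ?Z = "\<lambda>W. \<tau> \<cdot>\<^sub>m W + 1 \<cdot>\<^sub>m (K * (W * K))"
  have Z: "J * ?Z M = ?Z M * J" "K * ?Z M = ?Z M * K" "?Z M \<in> carrier_mat n n"
    if M: "M \<in> carrier_mat n n" "J * M = M * J" for M
  proof -
    show "J * ?Z M = ?Z M * J"
      using J K M sandwich_commutes[OF M] by (intro commutes_scaled_sum) auto
    have "K * ?Z M = \<tau> \<cdot>\<^sub>m (K * M) + \<tau> \<cdot>\<^sub>m (M * K)"
      using K M(1) by (simp add: mult_add_distrib_mat[of _ n n _ n] smult anticommuting_mult_left smult_one_mat)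
    also have "\<dots> = \<tau> \<cdot>\<^sub>m (M * K) + \<tau> \<cdot>\<^sub>m (K * M)"
      using K M(1) by (intro comm_add_mat[of _ n n]) auto
    also have "\<dots> = ?Z M * K"
      using K M(1) by (simp add: add_mult_distrib_mat[of _ n n _ _ n] smult assoc KK scalar_mat_mult smult_one_mat)
    finally show "K * ?Z M = ?Z M * K" .
    show "?Z M \<in> carrier_mat n n" using K M(1) by simp
  qed
  have JW: "J * W \<in> carrier_mat n n" "J * (J * W) = (J * W) * J"
    using J W(1) by (simp_all add: assoc W(2)[symmetric])
  have "nonscalar n (?Z W) \<or> nonscalar n (?Z (J * W))"
  proof (rule ccontr)
    assume "\<not> (nonscalar n (?Z W) \<or> nonscalar n (?Z (J * W)))"
    then obtain c d where c: "?Z W = c \<cdot>\<^sub>m 1\<^sub>m n" and d: "?Z (J * W) = d \<cdot>\<^sub>m 1\<^sub>m n"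
      using Z(3)[OF W(1,2)] Z(3)[OF JW] unfolding nonscalar_def by blast
    have KW: "K * (W * K) \<in> carrier_mat n n" using K W(1) by simp
    have e: "\<tau> \<cdot>\<^sub>m (J * W) + J * (K * (W * K)) = c \<cdot>\<^sub>m J"
    proof -
      have "J * ?Z W = c \<cdot>\<^sub>m J" unfolding c using J by (simp add: scalar_mat_mult)
      then show ?thesis
        using J W(1) KW by (simp add: mult_add_distrib_mat[of _ n n _ n] smult smult_one_mat)
    qed
    have "K * ((J * W) * K) = (- 1) \<cdot>\<^sub>m (J * (K * (W * K)))"
      using J K W(1) by (simp add: anticommuting_mult_left assoc smult smult_one_mat)
    then have e': "\<tau> \<cdot>\<^sub>m (J * W) + (- 1) \<cdot>\<^sub>m (J * (K * (W * K))) = d \<cdot>\<^sub>m 1\<^sub>m n"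
      using d by (simp add: smult_one_mat)
    have two: "(2 * \<tau>) \<cdot>\<^sub>m (J * W) = c \<cdot>\<^sub>m J + d \<cdot>\<^sub>m 1\<^sub>m n"
      unfolding e[symmetric] e'[symmetric] using J K W(1) JW(1) KW
      by (intro eq_matI) (auto simp: algebra_simps simp del: index_mult_mat(1))
    have "(J * W) *\<^sub>v x = J *\<^sub>v (W *\<^sub>v x)"
      using J W(1) x(1) by (rule assoc_mult_mat_vec)
    also have "\<dots> = 0\<^sub>v n"
      unfolding W(3) using J by (rule mult_mat_zero_vec)
    finally have "((2 * \<tau>) \<cdot>\<^sub>m (J * W)) *\<^sub>v x = 0\<^sub>v n"
      using JW(1) x(1) by (simp add: smult_mat_mult_vec) (auto intro!: eq_vecI)
    moreover have "(c \<cdot>\<^sub>m J + d \<cdot>\<^sub>m 1\<^sub>m n) *\<^sub>v x = c \<cdot>\<^sub>v (J *\<^sub>v x) + d \<cdot>\<^sub>v x"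
      using J x(1) by (subst add_mult_distrib_mat_vec[of _ n n]) (auto simp: smult_mat_mult_vec[of _ n] scalar_mat_mult_vec)
    moreover have "c \<cdot>\<^sub>v (J *\<^sub>v x) + d \<cdot>\<^sub>v x = d \<cdot>\<^sub>v x + c \<cdot>\<^sub>v (J *\<^sub>v x)"
      using x Jx by (intro comm_add_vec[of _ n]) auto
    ultimately have "d = 0 \<and> c = 0"
      using complex_structure_independent[OF J JJ x(1,2), of d c] two by simp
    then have z: "(2 * \<tau>) \<cdot>\<^sub>m (J * W) = 0\<^sub>m n n"
      using two J by (auto intro!: eq_matI)
    have "J * W = (1 / (2 * \<tau>)) \<cdot>\<^sub>m ((2 * \<tau>) \<cdot>\<^sub>m (J * W))"
      using assms by (simp add: smult_smult_mat smult_one_mat)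
    also have "\<dots> = 0\<^sub>m n n" unfolding z by simp
    finally have "J * W = 0\<^sub>m n n" .
    then have "(- 1) \<cdot>\<^sub>m W = 0\<^sub>m n n"
      using anticommuting_mult_left(1)[OF W(1)] J by simp
    then have "(- 1) \<cdot>\<^sub>m ((- 1) \<cdot>\<^sub>m W) = 0\<^sub>m n n" by simp
    then have "W = 0\<^sub>m n n" by (simp add: smult_smult_mat smult_one_mat)
    then have "W = 0 \<cdot>\<^sub>m 1\<^sub>m n" by (auto intro!: eq_matI)
    then show False using W(4) unfolding nonscalar_def by blast
  qed
  then show ?thesis using Z[OF W(1,2)] Z[OF JW] by blast
qed

text \<open>
  Any \<open>K X K\<close> is killed by \<open>K\<close> from both sides. It is nonzero if \<open>X\<close> leads from the image of \<open>K\<close> back out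
  of its kernel, for which \<open>X\<close> is taken to be the complex rank one matrix sending \<open>u = K v\<close> to a nonzero
  complex multiple of \<open>v\<close>.
\<close>

lemma anticommuting_square_zero_common_commutant:
  assumes "\<tau> = 0" "K \<noteq> 0\<^sub>m n n"
  shows "\<exists>Z. nonscalar n Z \<and> J * Z = Z * J \<and> K * Z = Z * K"
proof -
  note assoc = assoc_mult_mat[of _ n n _ n _ n]
  have "\<exists>v \<in> carrier_vec n. K *\<^sub>v v \<noteq> 0\<^sub>v n"
  proof (rule ccontr)
    assume none: "\<not> ?thesis"
    have "K = 0\<^sub>m n n"
    proof (rule eq_matI)
      fix i j assume "i < dim_row (0\<^sub>m n n :: real mat)" "j < dim_col (0\<^sub>m n n :: real mat)"
      then have ij: "i < n" "j < n" by auto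
      have "(K *\<^sub>v unit_vec n j) $ i = (0\<^sub>v n :: real vec) $ i" using none by simp
      then show "K $$ (i, j) = 0\<^sub>m n n $$ (i, j)" using ij K by simp
    qed (use K in auto)
    then show False using assms by simp
  qed
  then obtain v where v: "v \<in> carrier_vec n" "K *\<^sub>v v \<noteq> 0\<^sub>v n" by blast
  define u where "u = K *\<^sub>v v"
  have u: "u \<in> carrier_vec n" "u \<noteq> 0\<^sub>v n" using v K unfolding u_def by auto
  have KK0: "K * K = 0\<^sub>m n n" unfolding KK \<open>\<tau> = 0\<close> by (auto intro!: eq_matI)
  have Ku: "K *\<^sub>v u = 0\<^sub>v n"
    using v K unfolding u_def by (simp add: assoc_mult_mat_vec[symmetric] KK0 zero_mult_mat_vec)
  let ?X = "complex_outer J v u"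
  note X = complex_outer_closed(3)[OF J JJ v(1) u(1)] complex_outer_commutes[OF J JJ v(1) u(1)]
  let ?Z = "K * (?X * K)"
  have Z: "?Z \<in> carrier_mat n n" using K X(1) by simp
  have KZ: "K * ?Z = ?Z * K"
  proof -
    have "K * ?Z = 0\<^sub>m n n"
      using anticommuting_mult_left(2)[of "?X * K"] K X(1) \<open>\<tau> = 0\<close> by (auto intro!: eq_matI simp del: index_mult_mat(1))
    moreover have "?Z * K = 0\<^sub>m n n"
      using K X(1) by (simp add: assoc KK0)
    ultimately show ?thesis by simp
  qed
  have Zvec: "?Z *\<^sub>v y = K *\<^sub>v (?X *\<^sub>v (K *\<^sub>v y))" if "y \<in> carrier_vec n" for y
    using K X(1) that by (simp add: assoc_mult_mat_vec[of _ n n _ n])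
  have "?Z *\<^sub>v u = 0\<^sub>v n"
    unfolding Zvec[OF u(1)] Ku using K X(1) by (simp add: mult_mat_zero_vec)
  moreover have "?Z \<noteq> 0\<^sub>m n n"
  proof
    assume "?Z = 0\<^sub>m n n"
    then have "K *\<^sub>v (?X *\<^sub>v u) = 0\<^sub>v n"
      using Zvec[OF v(1)] v(1) by (simp add: u_def zero_mult_mat_vec)
    moreover have "K *\<^sub>v (J *\<^sub>v v) = (- 1) \<cdot>\<^sub>v (J *\<^sub>v u)"
    proof -
      have "J *\<^sub>v u = (J * K) *\<^sub>v v" unfolding u_def using J K v(1) by simp
      also have "\<dots> = (- 1) \<cdot>\<^sub>v (K *\<^sub>v (J *\<^sub>v v))"
        unfolding JK using J K v(1) by (simp add: smult_mat_mult_vec[of _ n])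
      finally show ?thesis using J K v(1) by (auto simp: smult_smult_assoc intro!: eq_vecI simp del: index_mult_mat_vec)
    qed
    moreover have "K *\<^sub>v (?X *\<^sub>v u) = (u \<bullet> u) \<cdot>\<^sub>v (K *\<^sub>v v) + (- (u \<bullet> (J *\<^sub>v u))) \<cdot>\<^sub>v (K *\<^sub>v (J *\<^sub>v v))"
      unfolding complex_outer_mult_vec[OF J JJ v(1) u(1) u(1)]
      using K J v(1) by (simp add: mult_add_distrib_mat_vec[of _ n n] mult_mat_vec[of _ n n])
    ultimately have "(u \<bullet> u) \<cdot>\<^sub>v u + (u \<bullet> (J *\<^sub>v u)) \<cdot>\<^sub>v (J *\<^sub>v u) = 0\<^sub>v n"
      by (simp add: u_def[symmetric] smult_smult_assoc)
    then have "u \<bullet> u = 0"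
      using complex_structure_independent[OF J JJ u] by blast
    then show False using real_vec_self_scalar_prod_eq_0 u by blast
  qed
  ultimately have "nonscalar n ?Z"
    using nonscalarI[OF Z _ u] by blast
  then show ?thesis using sandwich_commutes[OF X] KZ by blast
qed

lemma anticommuting_common_commutant:
  "\<exists>Z. nonscalar n Z \<and> J * Z = Z * J \<and> K * Z = Z * K"
proof (cases "K = 0\<^sub>m n n")
  case True
  obtain W where "nonscalar n W" "J * W = W * J"
    using ex_nonscalar_commuting_with_kernel by blast
  then show ?thesis using True by (auto simp: nonscalar_def)
next
  case False
  then show ?thesis
    using anticommuting_invertible_common_commutant anticommuting_square_zero_common_commutant by blast
qed

end

text \<open>
  The anticommutator \<open>J L + L J\<close> commutes with \<open>J\<close> and \<open>L\<close>, since \<open>J (J L + L J) = - L + J L J\<close> is symmetric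
  under moving \<open>J\<close> to the right. If it is a scalar \<open>c\<close>, then subtracting from \<open>L\<close> its component \<open>- (c/2) J\<close>
  leaves a matrix \<open>K\<close> that anticommutes with \<open>J\<close> and whose square is \<open>c\<^sup>2/4 - 1\<close>.
\<close>

lemma complex_structures_common_commutant:
  fixes J L :: "real mat"
  assumes n: "n \<ge> 3" and J: "J \<in> carrier_mat n n" and JJ: "J * J = (- 1) \<cdot>\<^sub>m 1\<^sub>m n"
    and L: "L \<in> carrier_mat n n" and LL: "L * L = (- 1) \<cdot>\<^sub>m 1\<^sub>m n"
  shows "\<exists>Z. nonscalar n Z \<and> J * Z = Z * J \<and> L * Z = Z * L"
proof -
  note assoc = assoc_mult_mat[of _ n n _ n _ n]
  note distrib = add_mult_distrib_mat[of _ n n _ _ n] mult_add_distrib_mat[of _ n n _ n]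
  note smult = mult_smult_distrib[of _ n n _ n] mult_smult_assoc_mat[of _ n n _ n] smult_smult_mat
  have JJM: "J * (J * M) = (- 1) \<cdot>\<^sub>m M" if "M \<in> carrier_mat n n" for M
    using J that by (simp add: assoc[symmetric] JJ scalar_mat_mult)
  have LLM: "L * (L * M) = (- 1) \<cdot>\<^sub>m M" if "M \<in> carrier_mat n n" for M
    using L that by (simp add: assoc[symmetric] LL scalar_mat_mult)
  let ?S = "J * L + L * J"
  have S: "?S \<in> carrier_mat n n" using J L by simp
  show ?thesis
  proof (cases "nonscalar n ?S")
    case True
    have "J * ?S = (- 1) \<cdot>\<^sub>m L + J * (L * J)"
      using J L by (simp add: distrib JJM)
    also have "\<dots> = J * (L * J) + (- 1) \<cdot>\<^sub>m L"
      using J L by (intro comm_add_mat[of _ n n]) auto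
    also have "\<dots> = ?S * J"
      using J L by (simp add: distrib assoc JJ scalar_mat_mult)
    finally have JS: "J * ?S = ?S * J" .
    have "L * ?S = L * (J * L) + (- 1) \<cdot>\<^sub>m J"
      using J L by (simp add: distrib LLM)
    also have "\<dots> = (- 1) \<cdot>\<^sub>m J + L * (J * L)"
      using J L by (intro comm_add_mat[of _ n n]) auto
    also have "\<dots> = ?S * L"
      using J L by (simp add: distrib assoc LL scalar_mat_mult)
    finally have "L * ?S = ?S * L" .
    then show ?thesis using True JS by blast
  next
    case False
    then obtain c where c: "?S = c \<cdot>\<^sub>m 1\<^sub>m n" using S unfolding nonscalar_def by blast
    have S_index: "(J * L) $$ (i, j) + (L * J) $$ (i, j) = c * (if i = j then 1 else 0)"
      if "i < n" "j < n" for i j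
      using arg_cong[OF c, of "\<lambda>M. M $$ (i, j)"] that J L by (simp del: index_mult_mat(1))
    let ?K = "L + (c / 2) \<cdot>\<^sub>m J"
    have K: "?K \<in> carrier_mat n n" using J L by simp
    have LJ: "L * J \<in> carrier_mat n n" "J * L \<in> carrier_mat n n" using J L by auto
    have "J * ?K = (- 1) \<cdot>\<^sub>m (?K * J)"
    proof (rule eq_matI)
      fix i j assume "i < dim_row ((- 1) \<cdot>\<^sub>m (?K * J))" "j < dim_col ((- 1) \<cdot>\<^sub>m (?K * J))"
      then have ij: "i < n" "j < n" using J L by auto
      then show "(J * ?K) $$ (i, j) = ((- 1) \<cdot>\<^sub>m (?K * J)) $$ (i, j)"
        using J L LJ S_index[OF ij] by (auto simp: distrib smult JJ simp del: index_mult_mat(1))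
    qed (use J L in auto)
    moreover have "?K * ?K = (c * c / 4 - 1) \<cdot>\<^sub>m 1\<^sub>m n"
    proof (rule eq_matI)
      fix i j assume "i < dim_row ((c * c / 4 - 1) \<cdot>\<^sub>m 1\<^sub>m n :: real mat)" "j < dim_col ((c * c / 4 - 1) \<cdot>\<^sub>m 1\<^sub>m n :: real mat)"
      then have ij: "i < n" "j < n" by auto
      have "(?K * ?K) $$ (i, j) = (L * L) $$ (i, j) + (c / 2) * ((J * L) $$ (i, j) + (L * J) $$ (i, j))
          + (c / 2) * (c / 2) * (J * J) $$ (i, j)"
        using ij J L LJ by (simp add: distrib smult algebra_simps del: index_mult_mat(1))
      also have "\<dots> = ((c * c / 4 - 1) \<cdot>\<^sub>m 1\<^sub>m n) $$ (i, j)"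
        using ij unfolding S_index[OF ij] LL JJ by (simp add: field_simps)
      finally show "(?K * ?K) $$ (i, j) = ((c * c / 4 - 1) \<cdot>\<^sub>m 1\<^sub>m n) $$ (i, j)" .
    qed (use J L in auto)
    ultimately obtain Z where Z: "nonscalar n Z" "J * Z = Z * J" "?K * Z = Z * ?K"
      using anticommuting_common_commutant[OF n J JJ K] by blast
    have Zc: "Z \<in> carrier_mat n n" using Z(1) by (simp add: nonscalar_def)
    have "L = 1 \<cdot>\<^sub>m ?K + (- (c / 2)) \<cdot>\<^sub>m J"
      using J L by (intro eq_matI) auto
    moreover have "Z * (1 \<cdot>\<^sub>m ?K + (- (c / 2)) \<cdot>\<^sub>m J) = (1 \<cdot>\<^sub>m ?K + (- (c / 2)) \<cdot>\<^sub>m J) * Z"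
      using Z Zc K J by (intro commutes_scaled_sum[of _ n]) auto
    ultimately have "L * Z = Z * L" by simp
    then show ?thesis using Z by blast
  qed
qed

lemma outer_common_commutant:
  assumes n: "n \<ge> 3"
    and "x \<in> carrier_vec n" "y \<in> carrier_vec n" "u \<in> carrier_vec n" "v \<in> carrier_vec n"
  shows "\<exists>Z. nonscalar n Z \<and> outer x y * Z = Z * outer x y \<and> outer u v * Z = Z * outer u v"
proof -
  obtain z where z: "z \<in> carrier_vec n" "z \<noteq> 0\<^sub>v n" "z \<bullet> y = 0" "z \<bullet> v = 0"
    using ex_vec_orthogonal_pair[OF n assms(3,5)] by blast
  obtain w where w: "w \<in> carrier_vec n" "w \<noteq> 0\<^sub>v n" "w \<bullet> x = 0" "w \<bullet> u = 0"
    using ex_vec_orthogonal_pair[OF n assms(2,4)] by blast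
  have "outer a b * outer z w = outer z w * outer a b"
    if "a \<in> carrier_vec n" "b \<in> carrier_vec n" "z \<bullet> b = 0" "w \<bullet> a = 0" for a b
    using that z w comm_scalar_prod[OF z(1) that(2)]
    by (simp add: outer_mult_outer[of _ n]) (auto simp: outer_def intro!: eq_matI)
  then show ?thesis
    using assms z w nonscalar_outer[OF n z(1) w(1) z(2) w(2)] by blast
qed

text \<open>
  The conditions on \<open>w\<close> make \<open>Z x = 0\<close>, and those on \<open>z\<close> make \<open>y\<^sup>T Z = 0\<close>.
\<close>

lemma outer_complex_structure_common_commutant:
  assumes n: "n \<ge> 3" and x: "x \<in> carrier_vec n" "x \<noteq> 0\<^sub>v n" and y: "y \<in> carrier_vec n"
    and J: "J \<in> carrier_mat n n" and JJ: "J * J = (- 1) \<cdot>\<^sub>m 1\<^sub>m n"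
  shows "\<exists>Z. nonscalar n Z \<and> outer x y * Z = Z * outer x y \<and> J * Z = Z * J"
proof -
  have Jx: "J *\<^sub>v x \<in> carrier_vec n" "J\<^sup>T *\<^sub>v y \<in> carrier_vec n" using J x y by auto
  obtain z where z: "z \<in> carrier_vec n" "z \<noteq> 0\<^sub>v n" "z \<bullet> y = 0" "z \<bullet> (J\<^sup>T *\<^sub>v y) = 0"
    using ex_vec_orthogonal_pair[OF n y Jx(2)] by blast
  obtain w where w: "w \<in> carrier_vec n" "w \<noteq> 0\<^sub>v n" "w \<bullet> x = 0" "w \<bullet> (J *\<^sub>v x) = 0"
    using ex_vec_orthogonal_pair[OF n x(1) Jx(1)] by blast
  let ?Z = "complex_outer J z w"
  note c = complex_outer_closed[OF J JJ z(1) w(1)]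
  note Z = nonscalar_complex_outer[OF J JJ z(1) w(1) z(2) w(2) x w(3,4)]
  have "y \<bullet> z = 0" "y \<bullet> (J *\<^sub>v z) = 0"
    using z comm_scalar_prod[OF z(1) y] comm_scalar_prod[OF z(1) Jx(2)]
      transpose_vec_mult_scalar[OF J z(1) y] by simp_all
  then have "outer x y * ?Z = 0\<^sub>m n n"
    using J x y z w c
    by (simp add: complex_outer_def mult_add_distrib_mat[of _ n n _ n] outer_carrier outer_mult_outer[of _ n])
      (auto simp: outer_def intro!: eq_matI)
  moreover have "?Z * outer x y = 0\<^sub>m n n"
    unfolding mult_outer[OF c(3) x(1) y] Z(1) using y by (auto simp: outer_def intro!: eq_matI)
  ultimately show ?thesis using Z(2) complex_outer_commutes[OF J JJ z(1) w(1)] by auto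
qed

lemma nonscalar_complex_structure:
  assumes n: "n \<ge> 3" and J: "J \<in> carrier_mat n n" and JJ: "J * J = (- 1) \<cdot>\<^sub>m 1\<^sub>m n"
  shows "nonscalar n J"
  unfolding nonscalar_def
proof (intro conjI allI notI)
  fix c assume c: "J = c \<cdot>\<^sub>m 1\<^sub>m n"
  have "J * J = c \<cdot>\<^sub>m (c \<cdot>\<^sub>m 1\<^sub>m n)"
    using J by (subst c) (simp add: scalar_mat_mult c)
  then have "(c \<cdot>\<^sub>m (c \<cdot>\<^sub>m 1\<^sub>m n)) $$ (0, 0) = ((- 1) \<cdot>\<^sub>m 1\<^sub>m n :: real mat) $$ (0, 0)"
    unfolding JJ by simp
  then have "c * c = - 1" using n by simp
  then show False using zero_le_square[of c] by linarith
qed fact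

lemma ex_standard_commuting_mat:
  assumes A: "A \<in> carrier_mat n n"
  shows "(\<exists>x \<in> carrier_vec n. \<exists>y \<in> carrier_vec n. x \<noteq> 0\<^sub>v n \<and> y \<noteq> 0\<^sub>v n \<and> A * outer x y = outer x y * A)
    \<or> (\<exists>J \<in> carrier_mat n n. J * J = (- 1) \<cdot>\<^sub>m 1\<^sub>m n \<and> A * J = J * A)"
  using real_eigenvalue_commutes_outer[OF A] ex_commuting_complex_structure[OF A] by blast

lemma ex_commuting_chain:
  assumes n: "n \<ge> 3" and A: "A \<in> carrier_mat n n" and B: "B \<in> carrier_mat n n"
  shows "\<exists>X Z Y. nonscalar n X \<and> nonscalar n Z \<and> nonscalar n Y
    \<and> A * X = X * A \<and> X * Z = Z * X \<and> Z * Y = Y * Z \<and> Y * B = B * Y"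
proof -
  note outer = nonscalar_outer[OF n] and J = nonscalar_complex_structure[OF n]
  from ex_standard_commuting_mat[OF A] show ?thesis
  proof (elim disjE bexE conjE)
    fix x y assume x: "x \<in> carrier_vec n" "y \<in> carrier_vec n" "x \<noteq> 0\<^sub>v n" "y \<noteq> 0\<^sub>v n"
      "A * outer x y = outer x y * A"
    from ex_standard_commuting_mat[OF B] show ?thesis
    proof (elim disjE bexE conjE)
      fix u v assume u: "u \<in> carrier_vec n" "v \<in> carrier_vec n" "u \<noteq> 0\<^sub>v n" "v \<noteq> 0\<^sub>v n"
        "B * outer u v = outer u v * B"
      show ?thesis
        using outer_common_commutant[OF n x(1,2) u(1,2)] outer[OF x(1-4)] outer[OF u(1-4)] x(5) u(5)
        by metis
    next
      fix L assume L: "L \<in> carrier_mat n n" "L * L = (- 1) \<cdot>\<^sub>m 1\<^sub>m n" "B * L = L * B"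
      show ?thesis
        using outer_complex_structure_common_commutant[OF n x(1,3,2) L(1,2)] outer[OF x(1-4)] J[OF L(1,2)] x(5) L(3)
        by metis
    qed
  next
    fix L assume L: "L \<in> carrier_mat n n" "L * L = (- 1) \<cdot>\<^sub>m 1\<^sub>m n" "A * L = L * A"
    from ex_standard_commuting_mat[OF B] show ?thesis
    proof (elim disjE bexE conjE)
      fix u v assume u: "u \<in> carrier_vec n" "v \<in> carrier_vec n" "u \<noteq> 0\<^sub>v n" "v \<noteq> 0\<^sub>v n"
        "B * outer u v = outer u v * B"
      show ?thesis
        using outer_complex_structure_common_commutant[OF n u(1,3,2) L(1,2)] outer[OF u(1-4)] J[OF L(1,2)] u(5) L(3)
        by metis
    next
      fix M assume M: "M \<in> carrier_mat n n" "M * M = (- 1) \<cdot>\<^sub>m 1\<^sub>m n" "B * M = M * B"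
      show ?thesis
        using complex_structures_common_commutant[OF n L(1,2) M(1,2)] J[OF L(1,2)] J[OF M(1,2)] L(3) M(3)
        by metis
    qed
  qed
qed

section \<open>Distances between matrices are at most four\<close>

lemma verts_commuting_graph_mat:
  "verts (commuting_graph (ring_mat TYPE(real) n ())) = {M. nonscalar n M}"
proof -
  have "ring_center (ring_mat TYPE(real) n ()) = {M \<in> carrier_mat n n. \<exists>c. M = c \<cdot>\<^sub>m 1\<^sub>m n}"
    unfolding ring_center_def ring_mat_simps
    using central_imp_scalar by (auto simp: scalar_mat_mult) 
  then show ?thesis
    by (auto simp: verts_commuting_graph nonscalar_def ring_mat_simps)
qed

lemma commuting_graph_mat_dist_le_4:
  assumes n: "n \<ge> 3" and A: "nonscalar n A" and B: "nonscalar n B"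
  shows "graph_dist (commuting_graph (ring_mat TYPE(real) n ())) A B \<le> 4"
proof -
  have "A \<in> carrier_mat n n" "B \<in> carrier_mat n n"
    using A B by (simp_all add: nonscalar_def)
  from ex_commuting_chain[OF n this]
  obtain X Z Y where "nonscalar n X" "nonscalar n Z" "nonscalar n Y"
    "A * X = X * A" "X * Z = Z * X" "Z * Y = Y * Z" "Y * B = B * Y"
    by blast
  then show ?thesis
    using graph_dist_le_commuting_chain[of "[A, X, Z, Y, B]" "ring_mat TYPE(real) n ()"] A B
    by (simp add: verts_commuting_graph_mat ring_mat_simps numeral_eq_enat eval_nat_numeral)
qed

section \<open>Two matrices at distance four\<close>

definition diag_count :: "nat \<Rightarrow> real mat" where
  "diag_count n = mat n n (\<lambda>(i, j). if i = j then real i else 0)"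

definition shift_mat :: "nat \<Rightarrow> real mat" where
  "shift_mat n = mat n n (\<lambda>(i, j). if j = Suc i then 1 else 0)"

text \<open>
  The columns are \<open>(1, ..., 1)\<close>, then \<open>e\<^sub>j - e\<^sub>0\<close> for \<open>0 < j < n - 1\<close>, and \<open>e\<^sub>0\<close>. All but the last of them
  are orthogonal to \<open>(1, ..., 1, 1 - n)\<close>, which therefore is the last row of the inverse.
\<close>

definition basis_mat :: "nat \<Rightarrow> real mat" where
  "basis_mat n = mat n n (\<lambda>(i, j). if j = 0 then 1
     else if j = n - 1 then (if i = 0 then 1 else 0)
     else (if i = j then 1 else 0) - (if i = 0 then 1 else 0))"

definition dual_basis_mat :: "nat \<Rightarrow> real mat" where
  "dual_basis_mat n = mat n n (\<lambda>(i, k). if i = n - 1 then (if k = n - 1 then - (real n - 1) else 1)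
     else if i = 0 then (if k = n - 1 then 1 else 0)
     else (if k = i then 1 else 0) - (if k = n - 1 then 1 else 0))"

lemma dual_basis_mat_basis_mat:
  assumes n: "n \<ge> 3"
  shows "dual_basis_mat n * basis_mat n = 1\<^sub>m n" "basis_mat n * dual_basis_mat n = 1\<^sub>m n"
proof -
  obtain m where m: "n = Suc (Suc m)" "m > 0"
    using n by (metis Suc_diff_Suc Suc_le_D Suc_le_mono gr0I less_numeral_extra(3) numeral_3_eq_3 not_less_eq_eq le_zero_eq)
  show 1: "dual_basis_mat n * basis_mat n = 1\<^sub>m n"
  proof (rule eq_matI)
    fix i j assume "i < dim_row (1\<^sub>m n :: real mat)" "j < dim_col (1\<^sub>m n :: real mat)"
    then have ij: "i < n" "j < n" by auto
    let ?q = "\<lambda>k. dual_basis_mat n $$ (i, k)"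
    have "(dual_basis_mat n * basis_mat n) $$ (i, j) = (\<Sum>k<n. ?q k * basis_mat n $$ (k, j))"
      using ij by (simp add: dual_basis_mat_def basis_mat_def scalar_prod_def lessThan_atLeast0)
    also have "\<dots> = (if i = j then 1 else 0)"
    proof -
      consider "j = 0" | "j = n - 1" "j \<noteq> 0" | "j \<noteq> 0" "j \<noteq> n - 1" by blast
      then show ?thesis
      proof cases
        case 1
        have "(\<Sum>k<n. ?q k * basis_mat n $$ (k, j)) = (\<Sum>k<Suc m. ?q k) + ?q (Suc m)"
          using 1 ij by (simp add: basis_mat_def m(1))
        also have "\<dots> = (if i = j then 1 else 0)"
          using ij 1 by (auto simp: dual_basis_mat_def m sum_subtractf sum.delta simp del: sum.lessThan_Suc)
        finally show ?thesis .
      next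
        case 2
        have "(\<Sum>k<n. ?q k * basis_mat n $$ (k, j)) = (\<Sum>k<n. if k = 0 then ?q 0 else 0)"
          using 2 ij by (intro sum.cong) (auto simp: basis_mat_def)
        also have "\<dots> = ?q 0" using ij by (simp add: sum.delta)
        finally show ?thesis using 2 ij m by (auto simp: dual_basis_mat_def)
      next
        case 3
        have "(\<Sum>k<n. ?q k * basis_mat n $$ (k, j))
            = (\<Sum>k<n. (if k = j then ?q j else 0) - (if k = 0 then ?q 0 else 0))"
          using 3 ij by (intro sum.cong) (auto simp: basis_mat_def)
        also have "\<dots> = ?q j - ?q 0" using ij by (simp add: sum_subtractf sum.delta)
        finally show ?thesis using 3 ij m by (auto simp: dual_basis_mat_def)
      qed
    qed
    finally show "(dual_basis_mat n * basis_mat n) $$ (i, j) = 1\<^sub>m n $$ (i, j)"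
      using ij by simp
  qed (auto simp: dual_basis_mat_def basis_mat_def)
  show "basis_mat n * dual_basis_mat n = 1\<^sub>m n"
    by (rule mat_mult_left_right_inverse[OF _ _ 1]) (auto simp: dual_basis_mat_def basis_mat_def)
qed

lemma basis_mat_cancel:
  assumes n: "n \<ge> 3" and M: "M \<in> carrier_mat n n"
  shows "dual_basis_mat n * (basis_mat n * M) = M" "basis_mat n * (dual_basis_mat n * M) = M"
proof -
  have c: "basis_mat n \<in> carrier_mat n n" "dual_basis_mat n \<in> carrier_mat n n"
    by (auto simp: basis_mat_def dual_basis_mat_def)
  show "dual_basis_mat n * (basis_mat n * M) = M" "basis_mat n * (dual_basis_mat n * M) = M"
    using c M dual_basis_mat_basis_mat[OF n] by (simp_all add: assoc_mult_mat[of _ n n _ n _ n, symmetric])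
qed

lemma mult_mat_index_sum:
  fixes M N :: "real mat"
  assumes "M \<in> carrier_mat n n" "N \<in> carrier_mat n n" "i < n" "j < n"
  shows "(M * N) $$ (i, j) = (\<Sum>k<n. M $$ (i, k) * N $$ (k, j))"
  using assms by (simp add: scalar_prod_def lessThan_atLeast0)

lemma diagonal_mult_index:
  fixes D M :: "real mat"
  assumes D: "D \<in> carrier_mat n n" "\<And>i j. \<lbrakk>i < n; j < n; i \<noteq> j\<rbrakk> \<Longrightarrow> D $$ (i, j) = 0"
    and M: "M \<in> carrier_mat n n" and ij: "i < n" "j < n"
  shows "(D * M) $$ (i, j) = D $$ (i, i) * M $$ (i, j)" "(M * D) $$ (i, j) = M $$ (i, j) * D $$ (j, j)"
proof -
  have "(D * M) $$ (i, j) = (\<Sum>k<n. D $$ (i, k) * M $$ (k, j))"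
    using mult_mat_index_sum D(1) M ij by blast
  also have "\<dots> = (\<Sum>k<n. if k = i then D $$ (i, i) * M $$ (i, j) else 0)"
    using ij D(2) by (intro sum.cong) auto
  finally show "(D * M) $$ (i, j) = D $$ (i, i) * M $$ (i, j)" using ij by simp
  have "(M * D) $$ (i, j) = (\<Sum>k<n. M $$ (i, k) * D $$ (k, j))"
    using mult_mat_index_sum D(1) M ij by blast
  also have "\<dots> = (\<Sum>k<n. if k = j then M $$ (i, j) * D $$ (j, j) else 0)"
    using ij D(2) by (intro sum.cong) auto
  finally show "(M * D) $$ (i, j) = M $$ (i, j) * D $$ (j, j)" using ij by simp
qed

lemma commutes_diag_count:
  assumes M: "M \<in> carrier_mat n n" and comm: "diag_count n * M = M * diag_count n"
    and "i < n" "j < n" "i \<noteq> j"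
  shows "M $$ (i, j) = 0"
proof -
  have D: "diag_count n \<in> carrier_mat n n" by (simp add: diag_count_def)
  have off_diagonal: "diag_count n $$ (i, j) = 0" if "i < n" "j < n" "i \<noteq> j" for i j
    using that by (simp add: diag_count_def)
  have "diag_count n $$ (i, i) * M $$ (i, j) = M $$ (i, j) * diag_count n $$ (j, j)"
    using diagonal_mult_index[OF D off_diagonal M assms(3,4)] comm by metis
  then show ?thesis using assms(3-5) by (simp add: diag_count_def)
qed

text \<open>
  Commuting with a nilpotent Jordan block means being an upper triangular Toeplitz matrix.
\<close>

lemma commutes_shift_mat:
  assumes M: "M \<in> carrier_mat n n" and comm: "shift_mat n * M = M * shift_mat n"
    and i: "i < n" and j: "j < n"
  shows "M $$ (i, j) = (if i \<le> j then M $$ (0, j - i) else 0)"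
proof -
  have L: "(shift_mat n * M) $$ (i, j) = (if Suc i < n then M $$ (Suc i, j) else 0)" if "i < n" "j < n" for i j
    using that M by (simp add: shift_mat_def scalar_prod_def if_distrib[of "\<lambda>x. x * _"] cong: if_cong)
  have R: "(M * shift_mat n) $$ (i, j) = (if j = 0 then 0 else M $$ (i, j - 1))" if "i < n" "j < n" for i j
  proof -
    have "(M * shift_mat n) $$ (i, j) = (\<Sum>k = 0..<n. if j = Suc k then M $$ (i, k) else 0)"
      using that M by (simp add: shift_mat_def scalar_prod_def if_distrib[of "\<lambda>x. _ * x"] cong: if_cong)
    also have "\<dots> = (if j = 0 then 0 else M $$ (i, j - 1))"
      using that by (cases j) auto
    finally show ?thesis .
  qed
  have step: "M $$ (Suc i, j) = (if j = 0 then 0 else M $$ (i, j - 1))" if "Suc i < n" "j < n" for i j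
    using L[of i j] R[of i j] comm that by simp
  show ?thesis
    using i j
  proof (induct i arbitrary: j)
    case (Suc i)
    then show ?case by (cases j) (auto simp: step)
  qed simp
qed

text \<open>
  A vector whose last coordinate is nonzero generates the whole space under the Jordan block. In
  coordinates, the equations are solved from the last one upwards: the one with index \<open>m - k\<close> is
  \<open>y\<^sub>k z\<^sub>m = 0\<close> once \<open>y\<^sub>0, ..., y\<^sub>k\<^sub>-\<^sub>1\<close> are known to vanish.
\<close>

lemma upper_toeplitz_kernel:
  fixes y z :: "nat \<Rightarrow> real"
  assumes z: "z m \<noteq> 0" and ker: "\<And>i. i \<le> m \<Longrightarrow> (\<Sum>j = i..m. y (j - i) * z j) = 0" and "k \<le> m"
  shows "y k = 0"
  using \<open>k \<le> m\<close>
proof (induct k rule: less_induct)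
  case (less k)
  have "0 = (\<Sum>j = m - k..m. y (j - (m - k)) * z j)" using ker by simp
  also have "\<dots> = y (m - (m - k)) * z m + (\<Sum>j = m - k..<m. y (j - (m - k)) * z j)"
    by (simp add: sum.last_plus)
  also have "(\<Sum>j = m - k..<m. y (j - (m - k)) * z j) = 0"
  proof (intro sum.neutral ballI)
    fix j assume "j \<in> {m - k..<m}"
    then have "j - (m - k) < k" by auto
    then show "y (j - (m - k)) * z j = 0" using less by simp
  qed
  finally show ?case using less.prems z by simp
qed

text \<open>
  The first column of \<open>M\<close> is \<open>M\<^sub>0\<^sub>0\<close> times the first unit vector, and \<open>E\<close> maps the kernel of \<open>M - M\<^sub>0\<^sub>0\<close> to
  itself. So this kernel contains the first column of \<open>E\<close>, whose last coordinate is nonzero.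
\<close>

lemma commutes_shift_mat_imp_scalar:
  assumes n: "n > 0" and M: "M \<in> carrier_mat n n" and comm: "shift_mat n * M = M * shift_mat n"
    and E: "E \<in> carrier_mat n n" "E * M = M * E" "E $$ (n - 1, 0) \<noteq> 0"
  shows "M = (M $$ (0, 0)) \<cdot>\<^sub>m 1\<^sub>m n"
proof -
  note T = commutes_shift_mat[OF M comm]
  have T0: "M $$ (j, 0) = 0" if "j < n" "j \<noteq> 0" for j
    using T[OF that(1) n] that(2) by simp
  \<comment> \<open>The Toeplitz coefficients of \<open>M - M\<^sub>0\<^sub>0\<close>, whose diagonal is zero.\<close>
  define y where "y k = (if k = 0 then 0 else M $$ (0, k))" for k
  have y0: "y k = 0" if "k \<le> n - 1" for k
  proof (rule upper_toeplitz_kernel[of "\<lambda>j. E $$ (j, 0)" "n - 1" y k])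
    fix i assume "i \<le> n - 1"
    then have i: "i < n" using n by simp
    have "(E * M) $$ (i, 0) = (\<Sum>j<n. E $$ (i, j) * M $$ (j, 0))"
      using mult_mat_index_sum E(1) M i n by blast
    also have "\<dots> = (\<Sum>j<n. if j = 0 then E $$ (i, 0) * M $$ (0, 0) else 0)"
      using n by (intro sum.cong) (auto simp: T0)
    also have "\<dots> = E $$ (i, 0) * M $$ (0, 0)" using n by (simp add: sum.delta)
    finally have l: "(E * M) $$ (i, 0) = E $$ (i, 0) * M $$ (0, 0)" .
    have "(M * E) $$ (i, 0) = (\<Sum>j<n. M $$ (i, j) * E $$ (j, 0))"
      using mult_mat_index_sum E(1) M i n by blast
    also have "\<dots> = (\<Sum>j = i..n - 1. M $$ (0, j - i) * E $$ (j, 0))"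
      using T[OF i] n by (intro sum.mono_neutral_cong_right) auto
    also have "\<dots> = (\<Sum>j = i..n - 1. y (j - i) * E $$ (j, 0) + (if j = i then M $$ (0, 0) * E $$ (i, 0) else 0))"
      by (intro sum.cong) (auto simp: y_def)
    also have "\<dots> = (\<Sum>j = i..n - 1. y (j - i) * E $$ (j, 0)) + M $$ (0, 0) * E $$ (i, 0)"
      using i by (simp add: sum.distrib sum.delta)
    finally show "(\<Sum>j = i..n - 1. y (j - i) * E $$ (j, 0)) = 0"
      using l E(2) by (simp add: mult.commute)
  qed (use E that in auto)
  show ?thesis
  proof (rule eq_matI)
    fix i j assume "i < dim_row ((M $$ (0, 0)) \<cdot>\<^sub>m 1\<^sub>m n)" "j < dim_col ((M $$ (0, 0)) \<cdot>\<^sub>m 1\<^sub>m n)"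
    then have ij: "i < n" "j < n" by auto
    then have "y (j - i) = 0" by (intro y0) auto
    then show "M $$ (i, j) = ((M $$ (0, 0)) \<cdot>\<^sub>m 1\<^sub>m n) $$ (i, j)"
      using T[OF ij] ij unfolding y_def by (cases i j rule: linorder_cases) (simp_all split: if_splits)
  qed (use M in auto)
qed

text \<open>
  The entry is the sum over \<open>S\<close> of the products of the coordinates of \<open>(1, ..., 1, 1 - n)\<close> and
  \<open>(1, ..., 1)\<close>. It is \<open>card S > 0\<close> if \<open>n - 1 \<notin> S\<close>, and \<open>card S - n < 0\<close> otherwise.
\<close>

lemma corner_of_conjugated_projection:
  assumes n: "n \<ge> 3" and S: "S \<subseteq> {..<n}" "S \<noteq> {}" "S \<noteq> {..<n}"
  shows "(dual_basis_mat n * (mat n n (\<lambda>(i, j). if i = j \<and> i \<in> S then 1 else 0) * basis_mat n)) $$ (n - 1, 0) \<noteq> 0"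
proof -
  let ?e = "mat n n (\<lambda>(i, j). if i = j \<and> i \<in> S then 1 else 0 :: real)"
  have fin: "finite S" using S finite_subset by blast
  have e: "(?e * basis_mat n) $$ (k, 0) = (if k \<in> S then 1 else 0)" if "k < n" for k
    using diagonal_mult_index(1)[of ?e n "basis_mat n" k 0] that n by (simp add: basis_mat_def)
  have "(dual_basis_mat n * (?e * basis_mat n)) $$ (n - 1, 0)
    = (\<Sum>k<n. dual_basis_mat n $$ (n - 1, k) * (?e * basis_mat n) $$ (k, 0))"
    by (rule mult_mat_index_sum) (use n in \<open>auto simp: dual_basis_mat_def basis_mat_def\<close>)
  also have "\<dots> = (\<Sum>k<n. if k \<in> S then (if k = n - 1 then - (real n - 1) else 1) else 0)"
    using n by (intro sum.cong) (auto simp: e dual_basis_mat_def simp del: index_mult_mat(1))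
  also have "\<dots> = (\<Sum>k\<in>S. if k = n - 1 then - (real n - 1) else 1)"
    using S(1) by (subst sum.inter_restrict[symmetric]) (auto simp: Int_absorb1)
  also have "\<dots> \<noteq> 0"
  proof (cases "n - 1 \<in> S")
    case True
    have "(\<Sum>k\<in>S. if k = n - 1 then - (real n - 1) else 1) = - (real n - 1) + (\<Sum>k\<in>S - {n - 1}. 1)"
      using sum.remove[OF fin True, of "\<lambda>k. if k = n - 1 then - (real n - 1) else 1"] by simp
    also have "\<dots> = real (card S) - real n"
      using sum.remove[OF fin True, of "\<lambda>k. 1 :: real"] by simp
    finally show ?thesis
      using psubset_card_mono[of "{..<n}" S] S by auto
  next
    case False
    then have "(\<Sum>k\<in>S. if k = n - 1 then - (real n - 1) else 1) = real (card S)"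
      by (subst sum.cong[of S S _ "\<lambda>_. 1"]) auto
    then show ?thesis using fin S by simp
  qed
  finally show ?thesis .
qed

text \<open>
  After the change of basis that turns the second matrix into the Jordan block, \<open>Y\<close> becomes a Toeplitz
  matrix that commutes with the projection onto an eigenspace of the diagonal matrix \<open>X\<close>, and hence
  is scalar.
\<close>

lemma no_commuting_pair_between:
  assumes n: "n \<ge> 3" and X: "nonscalar n X" and Y: "nonscalar n Y"
    and AX: "diag_count n * X = X * diag_count n"
    and BY: "(basis_mat n * (shift_mat n * dual_basis_mat n)) * Y = Y * (basis_mat n * (shift_mat n * dual_basis_mat n))"
    and XY: "X * Y = Y * X"
  shows False
proof -
  let ?P = "basis_mat n" and ?Q = "dual_basis_mat n" and ?N = "shift_mat n"
  note assoc = assoc_mult_mat[of _ n n _ n _ n]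
  have c: "?P \<in> carrier_mat n n" "?Q \<in> carrier_mat n n" "?N \<in> carrier_mat n n"
    by (auto simp: basis_mat_def dual_basis_mat_def shift_mat_def)
  have Xc: "X \<in> carrier_mat n n" and Yc: "Y \<in> carrier_mat n n"
    using X Y by (auto simp: nonscalar_def)
  \<comment> \<open>The projection onto an eigenspace of \<open>X\<close>, which is proper because \<open>X\<close> is not scalar.\<close>
  define S where "S = {i. i < n \<and> X $$ (i, i) = X $$ (0, 0)}"
  define e where "e = mat n n (\<lambda>(i, j). if i = j \<and> i \<in> S then 1 else 0 :: real)"
  have ec: "e \<in> carrier_mat n n" by (simp add: e_def)
  have X0: "X $$ (i, j) = 0" if "i < n" "j < n" "i \<noteq> j" for i j
    using commutes_diag_count[OF Xc AX] that by blast
  have "0 \<in> S" using n by (simp add: S_def)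
  moreover have "S \<noteq> {..<n}"
  proof
    assume "S = {..<n}"
    then have "X = (X $$ (0, 0)) \<cdot>\<^sub>m 1\<^sub>m n"
      using Xc X0 by (intro eq_matI) (auto simp: S_def)
    then show False using X unfolding nonscalar_def by blast
  qed
  ultimately have corner: "(?Q * (e * ?P)) $$ (n - 1, 0) \<noteq> 0"
    unfolding e_def by (intro corner_of_conjugated_projection[OF n]) (auto simp: S_def)
  have eY: "e * Y = Y * e"
  proof (rule eq_matI)
    fix i j assume "i < dim_row (Y * e)" "j < dim_col (Y * e)"
    then have ij: "i < n" "j < n" using Yc by (auto simp: e_def)
    have "X $$ (i, i) * Y $$ (i, j) = Y $$ (i, j) * X $$ (j, j)"
      using diagonal_mult_index[OF Xc X0 Yc ij] XY by metis
    then have "Y $$ (i, j) = 0 \<or> (i \<in> S \<longleftrightarrow> j \<in> S)"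
      using ij by (auto simp: S_def)
    moreover have "(e * Y) $$ (i, j) = e $$ (i, i) * Y $$ (i, j)" "(Y * e) $$ (i, j) = Y $$ (i, j) * e $$ (j, j)"
      by (rule diagonal_mult_index[OF ec _ Yc ij], simp add: e_def)+
    ultimately show "(e * Y) $$ (i, j) = (Y * e) $$ (i, j)"
      using ij by (auto simp: e_def)
  qed (use Yc in \<open>auto simp: e_def\<close>)
  let ?M = "?Q * (Y * ?P)" and ?E = "?Q * (e * ?P)"
  have M: "?M \<in> carrier_mat n n" and E: "?E \<in> carrier_mat n n" using c Yc ec by auto
  have "?Q * ((?P * (?N * ?Q) * Y) * ?P) = ?N * ?M"
    using c Yc by (simp add: assoc basis_mat_cancel[OF n])
  moreover have "?Q * ((Y * (?P * (?N * ?Q))) * ?P) = ?M * ?N"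
    using c Yc dual_basis_mat_basis_mat[OF n] by (simp add: assoc)
  ultimately have NM: "?N * ?M = ?M * ?N" using BY by simp
  have "?E * ?M = ?Q * ((e * Y) * ?P)" "?M * ?E = ?Q * ((Y * e) * ?P)"
    using c Yc ec by (simp_all add: assoc basis_mat_cancel[OF n])
  then have "?E * ?M = ?M * ?E" using eY by simp
  then have "?M = (?M $$ (0, 0)) \<cdot>\<^sub>m 1\<^sub>m n"
    using n by (intro commutes_shift_mat_imp_scalar[OF _ M NM E _ corner]) auto
  then obtain y where y: "?M = y \<cdot>\<^sub>m 1\<^sub>m n" by blast
  have "Y = ?P * (?M * ?Q)"
    using c Yc dual_basis_mat_basis_mat[OF n] by (simp add: assoc basis_mat_cancel[OF n])
  also have "\<dots> = y \<cdot>\<^sub>m 1\<^sub>m n"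
    unfolding y using c dual_basis_mat_basis_mat[OF n] by (simp add: scalar_mat_mult mult_smult_distrib[of _ n n _ n])
  finally show False using Y unfolding nonscalar_def by blast
qed

theorem theorem2:
  fixes n :: nat
  assumes "n \<ge> 3"
  shows "graph_diameter (commuting_graph (ring_mat TYPE(real) n ())) = 4"
proof (rule antisym)
  let ?G = "commuting_graph (ring_mat TYPE(real) n ())"
  show "graph_diameter ?G \<le> 4"
    unfolding graph_diameter_def verts_commuting_graph_mat
    using commuting_graph_mat_dist_le_4[OF assms] by (intro Sup_least) auto
  let ?A = "diag_count n" and ?B = "basis_mat n * (shift_mat n * dual_basis_mat n)"
  have Ac: "?A \<in> carrier_mat n n" and Nc: "shift_mat n \<in> carrier_mat n n"
    and Pc: "basis_mat n \<in> carrier_mat n n" and Qc: "dual_basis_mat n \<in> carrier_mat n n"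
    by (auto simp: diag_count_def shift_mat_def basis_mat_def dual_basis_mat_def)
  then have Bc: "?B \<in> carrier_mat n n" by simp
  have A: "nonscalar n ?A"
    unfolding nonscalar_def
  proof (intro conjI allI notI)
    fix c assume c: "?A = c \<cdot>\<^sub>m 1\<^sub>m n"
    have "?A $$ (0, 0) = c" "?A $$ (1, 1) = c" unfolding c using assms by auto
    then show False using assms by (simp add: diag_count_def)
  qed fact
  have B: "nonscalar n ?B"
    unfolding nonscalar_def
  proof (intro conjI allI notI)
    fix c assume c: "?B = c \<cdot>\<^sub>m 1\<^sub>m n"
    have "shift_mat n = dual_basis_mat n * (?B * basis_mat n)"
      using Nc Pc Qc dual_basis_mat_basis_mat[OF assms]
      by (simp add: assoc_mult_mat[of _ n n _ n _ n] basis_mat_cancel[OF assms])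
    also have "\<dots> = c \<cdot>\<^sub>m 1\<^sub>m n"
      unfolding c using Pc Qc dual_basis_mat_basis_mat[OF assms]
      by (simp add: scalar_mat_mult mult_smult_distrib[of _ n n _ n])
    finally have "shift_mat n $$ (0, 1) = (c \<cdot>\<^sub>m 1\<^sub>m n) $$ (0, 1)" by simp
    then show False using assms by (simp add: shift_mat_def)
  qed fact
  have "?A \<noteq> ?B"
  proof
    assume "?A = ?B"
    then show False
      using no_commuting_pair_between[OF assms A A refl] by simp
  qed
  have "4 \<le> graph_dist ?G ?A ?B"
    using A B no_commuting_pair_between[OF assms]
    by (intro graph_dist_ge_4) (auto simp: verts_commuting_graph_mat ring_mat_simps)
  also have "\<dots> \<le> graph_diameter ?G"
    unfolding graph_diameter_def verts_commuting_graph_mat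
    using A B \<open>?A \<noteq> ?B\<close> by (intro Sup_upper) auto
  finally show "4 \<le> graph_diameter ?G" .
qed

end
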